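(* Let $f$ be a locally $1$-Lipschitz rational function on $\mathbb{Q}_p$. Then $f:\mathbb{Q}_p\to\mathbb{Q}_p$ is measure-preserving if and only if it is invertible and locally isometric.
   Context: $|\cdot|$ is the $p$-adic absolute value, $B_r(a)=\{x\in\mathbb{Q}_p:|x-a|\le r\}$, $\mu$ is Haar measure on $\mathbb{Q}_p$ with $\mu(B_{p^k}(a))=p^k$. A rational function on $\mathbb{Q}_p$ is $f=P/Q$ with $P,Q$ coprime polynomials over $\mathbb{Q}_p$ and $Q$ having no root in $\mathbb{Q}_p$. Locally $1$-Lipschitz (resp. locally isometric): for every $a\in\mathbb{Q}_p$ there is $r>0$ such that $|f(x)-f(y)|\le|x-y|$ (resp. $=|x-y|$) for all $x,y\in B_r(a)$. Invertible: bijective. Measure-preserving: $\mu(f^{-1}(A))=\mu(A)$ for all Borel $A$. *)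

theory Defs
  imports "HOL-Analysis.Analysis" "HOL-Computational_Algebra.Computational_Algebra"
begin

text \<open>The p-adic absolute value of a rational a/b in lowest terms.  It takes values in the powers
  p^k with integer k, and is 0 at 0.\<close>

definition rat_padic_abs :: "nat \<Rightarrow> rat \<Rightarrow> real" where
  "rat_padic_abs p x = (if x = 0 then 0 else
     (case quotient_of x of (a, b) \<Rightarrow>
        real p powi (int (multiplicity (int p) b) - int (multiplicity (int p) a))))"

context
  fixes p :: nat
  assumes p: "prime p"
begin

lemma padic_base_gt_1: "real p > 1" and padic_base_pos: "real p > 0"
  using prime_gt_1_nat[OF p] by simp_all

lemma rat_padic_abs_0 [simp]: "rat_padic_abs p 0 = 0"
  by (simp add: rat_padic_abs_def)

lemma rat_padic_abs_frac:
  assumes "a \<noteq> 0" "b \<noteq> 0"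
  shows "rat_padic_abs p (of_int a / of_int b) =
    real p powi (int (multiplicity (int p) b) - int (multiplicity (int p) a))"
proof -
  obtain c d where cd: "quotient_of (of_int a / of_int b) = (c, d)" by fastforce
  have d: "d > 0" using quotient_of_denom_pos[OF cd] .
  have eq: "of_int a / of_int b = (of_int c / of_int d :: rat)" using quotient_of_div[OF cd] .
  have "of_int (a * d) = (of_int (c * b) :: rat)"
    using eq assms d by (simp add: field_simps)
  hence ad: "a * d = c * b" by (simp only: of_int_eq_iff)
  have c: "c \<noteq> 0" using ad assms d by auto
  have pe: "prime_elem (int p)" using p by simp
  have "multiplicity (int p) a + multiplicity (int p) d = multiplicity (int p) c + multiplicity (int p) b"
    using prime_elem_multiplicity_mult_distrib[OF pe, of a d]
      prime_elem_multiplicity_mult_distrib[OF pe, of c b] assms c d ad by simp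
  hence "int (multiplicity (int p) d) - int (multiplicity (int p) c)
      = int (multiplicity (int p) b) - int (multiplicity (int p) a)" by linarith
  with cd assms show ?thesis by (simp add: rat_padic_abs_def)
qed

lemma rat_frac_cases:
  fixes x :: rat
  obtains a b where "b \<noteq> 0" "x = of_int a / of_int b"
  by (metis quotient_of_div quotient_of_denom_pos surj_pair less_irrefl)

lemma rat_padic_abs_nonneg [simp]: "0 \<le> rat_padic_abs p x"
  by (auto simp: rat_padic_abs_def split: prod.splits)

lemma rat_padic_abs_eq_0 [simp]: "rat_padic_abs p x = 0 \<longleftrightarrow> x = 0"
  using padic_base_pos by (auto simp: rat_padic_abs_def power_int_eq_0_iff split: prod.splits)

lemma rat_padic_abs_1 [simp]: "rat_padic_abs p 1 = 1"
  using rat_padic_abs_frac[of 1 1] by simp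

lemma rat_padic_abs_mult: "rat_padic_abs p (x * y) = rat_padic_abs p x * rat_padic_abs p y"
proof (cases "x = 0 \<or> y = 0")
  case False
  obtain a b where x: "b \<noteq> 0" "x = of_int a / of_int b" by (rule rat_frac_cases)
  obtain c d where y: "d \<noteq> 0" "y = of_int c / of_int d" by (rule rat_frac_cases)
  have nz: "a \<noteq> 0" "c \<noteq> 0" using False x y by auto
  have pe: "prime_elem (int p)" using p by simp
  have "x * y = of_int (a * c) / of_int (b * d)" using x y by simp
  hence "rat_padic_abs p (x * y) = real p powi (int (multiplicity (int p) (b * d))
      - int (multiplicity (int p) (a * c)))"
    using rat_padic_abs_frac[of "a * c" "b * d"] nz x y by simp
  also have "\<dots> = real p powi ((int (multiplicity (int p) b) - int (multiplicity (int p) a))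
      + (int (multiplicity (int p) d) - int (multiplicity (int p) c)))"
    using nz x y by (simp add: prime_elem_multiplicity_mult_distrib[OF pe] algebra_simps)
  also have "\<dots> = rat_padic_abs p x * rat_padic_abs p y"
    using padic_base_pos nz x y by (subst power_int_add) (auto simp: rat_padic_abs_frac)
  finally show ?thesis .
qed auto

lemma rat_padic_abs_ultra: "rat_padic_abs p (x + y) \<le> max (rat_padic_abs p x) (rat_padic_abs p y)"
proof (cases "x = 0 \<or> y = 0 \<or> x + y = 0")
  case True
  thus ?thesis by (auto simp: le_max_iff_disj)
next
  case False
  obtain a b where x: "b \<noteq> 0" "x = of_int a / of_int b" by (rule rat_frac_cases)
  obtain c d where y: "d \<noteq> 0" "y = of_int c / of_int d" by (rule rat_frac_cases)
  let ?v = "\<lambda>n. int (multiplicity (int p) n)"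
  define e where "e = b * d"
  define u w where "u = a * d" and "w = c * b"
  have e: "e \<noteq> 0" using x y by (simp add: e_def)
  have xu: "x = of_int u / of_int e" and yw: "y = of_int w / of_int e"
    using x y by (simp_all add: e_def u_def w_def)
  have s: "x + y = of_int (u + w) / of_int e" by (simp add: xu yw add_divide_distrib)
  have nz: "u \<noteq> 0" "w \<noteq> 0" "u + w \<noteq> 0"
    using False xu yw s by (auto simp del: of_int_add)
  have np: "\<not> is_unit (int p)" using p by (metis not_prime_unit prime_nat_int_transfer)
  have "min (multiplicity (int p) u) (multiplicity (int p) w) \<le> multiplicity (int p) (u + w)"
    by (rule multiplicity_geI[OF nz(3) np], rule dvd_add)
       (auto intro: multiplicity_dvd')
  hence "?v e - ?v (u + w) \<le> ?v e - ?v u \<or> ?v e - ?v (u + w) \<le> ?v e - ?v w" by linarith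
  hence "real p powi (?v e - ?v (u + w)) \<le> real p powi (?v e - ?v u) \<or>
     real p powi (?v e - ?v (u + w)) \<le> real p powi (?v e - ?v w)"
    using padic_base_gt_1 by (auto intro: power_int_increasing)
  thus ?thesis
    using nz e unfolding s
    by (simp add: le_max_iff_disj rat_padic_abs_frac xu yw del: of_int_add)
qed

lemma rat_padic_abs_minus [simp]: "rat_padic_abs p (- x) = rat_padic_abs p x"
proof -
  have "rat_padic_abs p (-1) * rat_padic_abs p (-1) = 1"
    using rat_padic_abs_mult[of "-1" "-1"] by simp
  hence "rat_padic_abs p (-1) = 1"
    using rat_padic_abs_nonneg[of "-1"] by (metis abs_of_nonneg abs_1 real_sqrt_abs2 real_sqrt_one)
  thus ?thesis using rat_padic_abs_mult[of "-1" x] by simp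
qed

lemma rat_padic_abs_diff_commute: "rat_padic_abs p (x - y) = rat_padic_abs p (y - x)"
  by (metis minus_diff_eq rat_padic_abs_minus)

lemma rat_padic_abs_triangle: "rat_padic_abs p (x + y) \<le> rat_padic_abs p x + rat_padic_abs p y"
  using rat_padic_abs_ultra[of x y] rat_padic_abs_nonneg[of x] rat_padic_abs_nonneg[of y] by linarith

lemma rat_padic_abs_inverse: "rat_padic_abs p (inverse x) = inverse (rat_padic_abs p x)"
proof (cases "x = 0")
  case False
  hence "rat_padic_abs p x * rat_padic_abs p (inverse x) = 1"
    using rat_padic_abs_mult[of x "inverse x"] by simp
  thus ?thesis by (metis inverse_unique)
qed auto

lemma rat_padic_abs_diff_triangle:
  "\<bar>rat_padic_abs p x - rat_padic_abs p y\<bar> \<le> rat_padic_abs p (x - y)"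
  using rat_padic_abs_triangle[of y "x - y"] rat_padic_abs_triangle[of x "y - x"]
    rat_padic_abs_diff_commute[of x y] by auto

lemma rat_padic_abs_int_le_1: "rat_padic_abs p (of_int a) \<le> 1"
proof (cases "a = 0")
  case False
  have "real p powi (- int (multiplicity (int p) a)) \<le> real p powi 0"
    using padic_base_gt_1 by (intro power_int_increasing) auto
  thus ?thesis using rat_padic_abs_frac[of a 1] False by simp
qed auto

lemma rat_padic_abs_p: "rat_padic_abs p (of_nat p) = 1 / real p"
proof -
  have "multiplicity (int p) (int p) = 1"
    using p by (intro multiplicity_self) auto
  thus ?thesis using rat_padic_abs_frac[of "int p" 1] padic_base_pos
    by (simp add: power_int_minus inverse_eq_divide)
qed

lemma rat_padic_abs_range: "x \<noteq> 0 \<Longrightarrow> \<exists>k. rat_padic_abs p x = real p powi k"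
  by (auto simp: rat_padic_abs_def split: prod.splits)

lemma rat_padic_abs_int_lt_1_iff: "rat_padic_abs p (of_int a) < 1 \<longleftrightarrow> int p dvd a"
proof
  assume "int p dvd a"
  then obtain c where c: "a = int p * c" by auto
  have "rat_padic_abs p (of_int a) = rat_padic_abs p (of_int c) / real p"
    by (simp add: c rat_padic_abs_mult rat_padic_abs_p)
  also have "\<dots> < 1" using rat_padic_abs_int_le_1[of c] padic_base_gt_1 by (simp add: field_simps)
  finally show "rat_padic_abs p (of_int a) < 1" .
next
  assume l: "rat_padic_abs p (of_int a) < 1"
  show "int p dvd a"
  proof (rule ccontr)
    assume n: "\<not> int p dvd a"
    hence "multiplicity (int p) a = 0" by (rule not_dvd_imp_multiplicity_0)
    thus False using l rat_padic_abs_frac[of a 1] n by (cases "a = 0") auto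
  qed
qed

end

definition rat_padic_Cauchy :: "nat \<Rightarrow> (nat \<Rightarrow> rat) \<Rightarrow> bool" where
  "rat_padic_Cauchy p X \<longleftrightarrow>
     (\<forall>e>0. \<exists>N. \<forall>m\<ge>N. \<forall>n\<ge>N. rat_padic_abs p (X m - X n) < e)"

definition rat_padic_null :: "nat \<Rightarrow> (nat \<Rightarrow> rat) \<Rightarrow> bool" where
  "rat_padic_null p X \<longleftrightarrow> (\<lambda>n. rat_padic_abs p (X n)) \<longlonglongrightarrow> 0"

definition rat_padic_rel :: "nat \<Rightarrow> ((nat \<Rightarrow> rat) \<times> (nat \<Rightarrow> rat)) set" where
  "rat_padic_rel p = {(X, Y). rat_padic_Cauchy p X \<and> rat_padic_Cauchy p Y \<and>
                              rat_padic_null p (\<lambda>n. X n - Y n)}"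

context
  fixes p :: nat
  assumes p: "prime p"
begin

lemma rat_padic_null_add: 
  assumes "rat_padic_null p X" "rat_padic_null p Y"
  shows "rat_padic_null p (\<lambda>n. X n + Y n)"
  unfolding rat_padic_null_def
proof (rule tendsto_sandwich[OF always_eventually always_eventually tendsto_const])
  show "(\<lambda>n. rat_padic_abs p (X n) + rat_padic_abs p (Y n)) \<longlonglongrightarrow> 0"
    using tendsto_add[OF assms[unfolded rat_padic_null_def]] by simp
qed (use p in \<open>auto intro: rat_padic_abs_triangle\<close>)

lemma rat_padic_null_minus: "rat_padic_null p X \<Longrightarrow> rat_padic_null p (\<lambda>n. - X n)"
  by (simp add: rat_padic_null_def rat_padic_abs_minus[OF p])

lemma rat_padic_null_mult_bounded:
  assumes "rat_padic_null p X" "\<And>n. rat_padic_abs p (Y n) \<le> B"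
  shows "rat_padic_null p (\<lambda>n. X n * Y n)"
  unfolding rat_padic_null_def
proof (rule tendsto_sandwich[OF always_eventually always_eventually tendsto_const])
  show "(\<lambda>n. rat_padic_abs p (X n) * B) \<longlonglongrightarrow> 0"
    using tendsto_mult_right[OF assms(1)[unfolded rat_padic_null_def], of B] by simp
qed (use p assms(2) in \<open>auto simp: rat_padic_abs_mult intro!: mult_left_mono\<close>)

lemma rat_padic_Cauchy_const: "rat_padic_Cauchy p (\<lambda>n. c)"
  by (auto simp: rat_padic_Cauchy_def rat_padic_abs_0[OF p])

lemma rat_padic_Cauchy_minus: "rat_padic_Cauchy p X \<Longrightarrow> rat_padic_Cauchy p (\<lambda>n. - X n)"
  unfolding rat_padic_Cauchy_def
  using rat_padic_abs_diff_commute[OF p] by (simp add: algebra_simps)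

lemma rat_padic_Cauchy_add:
  assumes "rat_padic_Cauchy p X" "rat_padic_Cauchy p Y"
  shows "rat_padic_Cauchy p (\<lambda>n. X n + Y n)"
  unfolding rat_padic_Cauchy_def
proof (intro allI impI)
  fix e :: real assume e: "e > 0"
  obtain N1 where 1: "\<And>m n. m \<ge> N1 \<Longrightarrow> n \<ge> N1 \<Longrightarrow> rat_padic_abs p (X m - X n) < e"
    using assms(1) e by (meson rat_padic_Cauchy_def)
  obtain N2 where 2: "\<And>m n. m \<ge> N2 \<Longrightarrow> n \<ge> N2 \<Longrightarrow> rat_padic_abs p (Y m - Y n) < e"
    using assms(2) e by (meson rat_padic_Cauchy_def)
  have "rat_padic_abs p (X m + Y m - (X n + Y n)) < e" if "m \<ge> max N1 N2" "n \<ge> max N1 N2" for m n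
    using rat_padic_abs_ultra[OF p, of "X m - X n" "Y m - Y n"] 1[of m n] 2[of m n] that
    by (auto simp: algebra_simps)
  thus "\<exists>N. \<forall>m\<ge>N. \<forall>n\<ge>N. rat_padic_abs p (X m + Y m - (X n + Y n)) < e" by blast
qed

lemma rat_padic_Cauchy_abs_converges:
  assumes "rat_padic_Cauchy p X"
  shows "convergent (\<lambda>n. rat_padic_abs p (X n))"
proof (rule Cauchy_convergent, rule metric_CauchyI)
  fix e :: real assume e: "e > 0"
  obtain N where N: "\<And>m n. m \<ge> N \<Longrightarrow> n \<ge> N \<Longrightarrow> rat_padic_abs p (X m - X n) < e"
    using assms(1) e by (meson rat_padic_Cauchy_def)
  have "dist (rat_padic_abs p (X m)) (rat_padic_abs p (X n)) < e" if "m \<ge> N" "n \<ge> N" for m n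
    using rat_padic_abs_diff_triangle[OF p, of "X m" "X n"] N[OF that] by (simp add: dist_real_def)
  thus "\<exists>M. \<forall>m\<ge>M. \<forall>n\<ge>M. dist (rat_padic_abs p (X m)) (rat_padic_abs p (X n)) < e" by blast
qed

lemma rat_padic_Cauchy_bounded:
  assumes "rat_padic_Cauchy p X"
  obtains B where "B > 0" "\<And>n. rat_padic_abs p (X n) \<le> B"
proof -
  have "Bseq (\<lambda>n. rat_padic_abs p (X n))"
    by (rule convergent_imp_Bseq[OF rat_padic_Cauchy_abs_converges[OF assms]])
  then obtain K where "K > 0" "\<forall>n. norm (rat_padic_abs p (X n)) \<le> K" by (auto simp: Bseq_def)
  thus ?thesis using that[of K] by (auto simp: abs_le_iff)
qed

lemma rat_padic_Cauchy_mult: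
  assumes "rat_padic_Cauchy p X" "rat_padic_Cauchy p Y"
  shows "rat_padic_Cauchy p (\<lambda>n. X n * Y n)"
  unfolding rat_padic_Cauchy_def
proof (intro allI impI)
  fix e :: real assume e: "e > 0"
  obtain B where B: "B > 0" "\<And>n. rat_padic_abs p (X n) \<le> B" using rat_padic_Cauchy_bounded[OF assms(1)] by blast
  obtain C where C: "C > 0" "\<And>n. rat_padic_abs p (Y n) \<le> C" using rat_padic_Cauchy_bounded[OF assms(2)] by blast
  have eC: "e / C > 0" and eB: "e / B > 0" using e B C by auto
  obtain N1 where 1: "\<And>m n. m \<ge> N1 \<Longrightarrow> n \<ge> N1 \<Longrightarrow> rat_padic_abs p (X m - X n) < e / C"
    using assms(1) eC unfolding rat_padic_Cauchy_def by meson
  obtain N2 where 2: "\<And>m n. m \<ge> N2 \<Longrightarrow> n \<ge> N2 \<Longrightarrow> rat_padic_abs p (Y m - Y n) < e / B"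
    using assms(2) eB unfolding rat_padic_Cauchy_def by meson
  have "rat_padic_abs p (X m * Y m - X n * Y n) < e" if "m \<ge> max N1 N2" "n \<ge> max N1 N2" for m n
  proof -
    have "rat_padic_abs p (X m - X n) * rat_padic_abs p (Y m) < e"
    proof -
      have "rat_padic_abs p (X m - X n) * rat_padic_abs p (Y m) \<le> rat_padic_abs p (X m - X n) * C"
        using C(2) p by (intro mult_left_mono) auto
      also have "\<dots> < e" using 1[of m n] that C(1) by (simp add: field_simps)
      finally show ?thesis .
    qed
    moreover have "rat_padic_abs p (X n) * rat_padic_abs p (Y m - Y n) < e"
    proof -
      have "rat_padic_abs p (X n) * rat_padic_abs p (Y m - Y n) \<le> B * rat_padic_abs p (Y m - Y n)"
        using B(2) p by (intro mult_right_mono) auto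
      also have "\<dots> < e" using 2[of m n] that B(1) by (simp add: field_simps)
      finally show ?thesis .
    qed
    moreover have "X m * Y m - X n * Y n = (X m - X n) * Y m + X n * (Y m - Y n)"
      by (simp add: algebra_simps)
    ultimately show ?thesis
      using rat_padic_abs_ultra[OF p, of "(X m - X n) * Y m" "X n * (Y m - Y n)"]
      by (auto simp: rat_padic_abs_mult[OF p])
  qed
  thus "\<exists>N. \<forall>m\<ge>N. \<forall>n\<ge>N. rat_padic_abs p (X m * Y m - X n * Y n) < e" by blast
qed

lemma rat_padic_Cauchy_not_null:
  assumes "rat_padic_Cauchy p X" "\<not> rat_padic_null p X"
  obtains b N where "b > 0" "\<And>n. n \<ge> N \<Longrightarrow> rat_padic_abs p (X n) > b"
proof -
  obtain L where L: "(\<lambda>n. rat_padic_abs p (X n)) \<longlonglongrightarrow> L"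
    using rat_padic_Cauchy_abs_converges[OF assms(1)] by (auto simp: convergent_def)
  have "L \<ge> 0" by (rule LIMSEQ_le_const[OF L]) (use p in auto)
  moreover have "L \<noteq> 0" using L assms(2) by (auto simp: rat_padic_null_def)
  ultimately have "L > L / 2" "L / 2 > 0" by auto
  from order_tendstoD(1)[OF L this(1)] this(2) show ?thesis
    using that[of "L / 2"] by (auto simp: eventually_sequentially)
qed

lemma rat_padic_Cauchy_inverse:
  assumes "rat_padic_Cauchy p X" "\<not> rat_padic_null p X"
  shows "rat_padic_Cauchy p (\<lambda>n. inverse (X n))"
  unfolding rat_padic_Cauchy_def
proof (intro allI impI)
  fix e :: real assume e: "e > 0"
  obtain b N where b: "b > 0" "\<And>n. n \<ge> N \<Longrightarrow> rat_padic_abs p (X n) > b"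
    using rat_padic_Cauchy_not_null[OF assms] by metis
  have eb: "e * (b * b) > 0" using e b by simp
  obtain M where M: "\<And>m n. m \<ge> M \<Longrightarrow> n \<ge> M \<Longrightarrow> rat_padic_abs p (X m - X n) < e * (b * b)"
    using assms(1) eb unfolding rat_padic_Cauchy_def by meson
  have "rat_padic_abs p (inverse (X m) - inverse (X n)) < e"
    if "m \<ge> max M N" "n \<ge> max M N" for m n
  proof -
    have g: "rat_padic_abs p (X m) > b" "rat_padic_abs p (X n) > b" using b that by auto
    hence nz: "X m \<noteq> 0" "X n \<noteq> 0" using b(1) p by (auto simp: rat_padic_abs_0)
    have "inverse (X m) - inverse (X n) = (X n - X m) * inverse (X m * X n)"
      using nz by (simp add: field_simps)
    hence "rat_padic_abs p (inverse (X m) - inverse (X n))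
        = rat_padic_abs p (X m - X n) / (rat_padic_abs p (X m) * rat_padic_abs p (X n))"
      by (simp only: rat_padic_abs_mult[OF p] rat_padic_abs_inverse[OF p]
           rat_padic_abs_diff_commute[OF p, of "X n"] divide_inverse)
    also have "\<dots> \<le> rat_padic_abs p (X m - X n) / (b * b)"
      using g b(1) p by (intro divide_left_mono mult_mono) (auto intro!: mult_pos_pos)
    also have "\<dots> < e" using M[of m n] that b(1) by (simp add: field_simps)
    finally show ?thesis .
  qed
  thus "\<exists>N. \<forall>m\<ge>N. \<forall>n\<ge>N. rat_padic_abs p (inverse (X m) - inverse (X n)) < e" by blast
qed

lemma rat_padic_Cauchy_diff:
  "rat_padic_Cauchy p X \<Longrightarrow> rat_padic_Cauchy p Y \<Longrightarrow> rat_padic_Cauchy p (\<lambda>n. X n - Y n)"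
  using rat_padic_Cauchy_add[OF _ rat_padic_Cauchy_minus, of X Y] by simp

lemma rat_padic_null_diff:
  "rat_padic_null p X \<Longrightarrow> rat_padic_null p Y \<Longrightarrow> rat_padic_null p (\<lambda>n. X n - Y n)"
  using rat_padic_null_add[OF _ rat_padic_null_minus, of X Y] by simp

lemma equiv_rat_padic_rel: "equiv {X. rat_padic_Cauchy p X} (rat_padic_rel p)"
proof (rule equivI)
  show "refl_on {X. rat_padic_Cauchy p X} (rat_padic_rel p)"
    by (auto simp: refl_on_def rat_padic_rel_def rat_padic_null_def rat_padic_abs_0[OF p])
  show "sym (rat_padic_rel p)"
    by (auto simp: sym_def rat_padic_rel_def dest: rat_padic_null_minus)
  show "trans (rat_padic_rel p)"
    by (auto simp: trans_def rat_padic_rel_def dest: rat_padic_null_add)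
qed (auto simp: rat_padic_rel_def)

lemma rat_padic_null_mult_diff:
  assumes "rat_padic_Cauchy p X" "rat_padic_Cauchy p Y'" 
    "rat_padic_null p (\<lambda>n. X n - X' n)" "rat_padic_null p (\<lambda>n. Y n - Y' n)"
  shows "rat_padic_null p (\<lambda>n. X n * Y n - X' n * Y' n)"
proof -
  obtain B where B: "\<And>n. rat_padic_abs p (X n) \<le> B" using rat_padic_Cauchy_bounded[OF assms(1)] by blast
  obtain C where C: "\<And>n. rat_padic_abs p (Y' n) \<le> C" using rat_padic_Cauchy_bounded[OF assms(2)] by blast
  show ?thesis
    using rat_padic_null_add[OF rat_padic_null_mult_bounded[where Y = X, OF assms(4) B]
        rat_padic_null_mult_bounded[where Y = Y', OF assms(3) C]]
    by (simp add: algebra_simps)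
qed

end

text \<open>The prime p is the cardinality of a type parameter, so that the p-adic numbers can be an
  instance of the type classes for fields and metric spaces.  Every prime is the cardinality of some
  such type.  The p-adic numbers are the completion of the rationals: Cauchy sequences of rationals
  with respect to the p-adic absolute value, modulo null sequences.\<close>

class prime_card = finite +
  assumes prime_card: "prime CARD('a)"

typedef (overloaded) ('p :: prime_card) padic =
  "{X. rat_padic_Cauchy CARD('p) X} // rat_padic_rel CARD('p)"
  using rat_padic_Cauchy_const[OF prime_card[where 'a='p]] by (auto simp: quotient_def)

definition padic_of_seq :: "(nat \<Rightarrow> rat) \<Rightarrow> 'p::prime_card padic" where
  "padic_of_seq X = Abs_padic (rat_padic_rel CARD('p) `` {X})"

definition padic_rep :: "'p::prime_card padic \<Rightarrow> nat \<Rightarrow> rat" where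
  "padic_rep x = (SOME X. X \<in> Rep_padic x)"

lemma padic_rep:
  fixes x :: "'p::prime_card padic"
  shows "rat_padic_Cauchy CARD('p) (padic_rep x)" "padic_of_seq (padic_rep x) = x"
proof -
  let ?p = "CARD('p)"
  note eq = equiv_rat_padic_rel[OF prime_card[where 'a='p]]
  obtain X where X: "rat_padic_Cauchy ?p X" "Rep_padic x = rat_padic_rel ?p `` {X}"
    using Rep_padic[of x] by (auto elim!: quotientE)
  have "X \<in> Rep_padic x" unfolding X(2) using X(1) by (intro equiv_class_self[OF eq]) auto
  hence "padic_rep x \<in> Rep_padic x" unfolding padic_rep_def by (rule someI[of "\<lambda>X. X \<in> Rep_padic x"])
  hence r: "(X, padic_rep x) \<in> rat_padic_rel ?p" by (simp add: X)
  thus "rat_padic_Cauchy ?p (padic_rep x)" by (simp add: rat_padic_rel_def)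
  show "padic_of_seq (padic_rep x) = x"
    using equiv_class_eq[OF eq r] X(2) by (metis padic_of_seq_def Rep_padic_inverse)
qed

lemma padic_of_seq_eq_iff:
  assumes "rat_padic_Cauchy CARD('p::prime_card) X" "rat_padic_Cauchy CARD('p) Y"
  shows "padic_of_seq X = (padic_of_seq Y :: 'p padic) \<longleftrightarrow> rat_padic_null CARD('p) (\<lambda>n. X n - Y n)"
proof -
  let ?p = "CARD('p)"
  note eq = equiv_rat_padic_rel[OF prime_card[where 'a='p]]
  have "padic_of_seq X = (padic_of_seq Y :: 'p padic) \<longleftrightarrow>
      rat_padic_rel ?p `` {X} = rat_padic_rel ?p `` {Y}"
    unfolding padic_of_seq_def using assms by (intro Abs_padic_inject) (auto intro: quotientI)
  also have "\<dots> \<longleftrightarrow> (X, Y) \<in> rat_padic_rel ?p"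
    using eq_equiv_class_iff[OF eq] assms by auto
  finally show ?thesis using assms by (simp add: rat_padic_rel_def)
qed

lemma padic_cases:
  fixes x :: "'p::prime_card padic"
  obtains X where "rat_padic_Cauchy CARD('p) X" "x = padic_of_seq X"
  using padic_rep by metis

lemma rat_padic_null_padic_rep_of_seq:
  assumes "rat_padic_Cauchy CARD('p::prime_card) X"
  shows "rat_padic_null CARD('p) (\<lambda>n. padic_rep (padic_of_seq X :: 'p padic) n - X n)"
  using padic_of_seq_eq_iff[OF padic_rep(1)[of "padic_of_seq X :: 'p padic"] assms] padic_rep(2) by auto

instantiation padic :: (prime_card) field
begin

definition zero_padic :: "'a padic" where "0 = padic_of_seq (\<lambda>n. 0)"
definition one_padic :: "'a padic" where "1 = padic_of_seq (\<lambda>n. 1)"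
definition plus_padic :: "'a padic \<Rightarrow> 'a padic \<Rightarrow> 'a padic" where
  "x + y = padic_of_seq (\<lambda>n. padic_rep x n + padic_rep y n)"
definition uminus_padic :: "'a padic \<Rightarrow> 'a padic" where
  "- x = padic_of_seq (\<lambda>n. - padic_rep x n)"
definition minus_padic :: "'a padic \<Rightarrow> 'a padic \<Rightarrow> 'a padic" where
  "x - y = x + - y" for x y :: "'a padic"
definition times_padic :: "'a padic \<Rightarrow> 'a padic \<Rightarrow> 'a padic" where
  "x * y = padic_of_seq (\<lambda>n. padic_rep x n * padic_rep y n)"
definition inverse_padic :: "'a padic \<Rightarrow> 'a padic" where
  "inverse x = (if x = 0 then 0 else padic_of_seq (\<lambda>n. inverse (padic_rep x n)))"
definition divide_padic :: "'a padic \<Rightarrow> 'a padic \<Rightarrow> 'a padic" where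
  "x div y = x * inverse y" for x y :: "'a padic"

lemma padic_of_seq_add:
  assumes "rat_padic_Cauchy CARD('a) X" "rat_padic_Cauchy CARD('a) Y"
  shows "padic_of_seq X + padic_of_seq Y = (padic_of_seq (\<lambda>n. X n + Y n) :: 'a padic)"
proof -
  note p = prime_card[where 'a='a]
  show ?thesis unfolding plus_padic_def
    using rat_padic_null_add[OF p rat_padic_null_padic_rep_of_seq[OF assms(1)] rat_padic_null_padic_rep_of_seq[OF assms(2)]]
    by (subst padic_of_seq_eq_iff) (auto intro!: rat_padic_Cauchy_add p padic_rep assms simp: algebra_simps)
qed

lemma padic_of_seq_minus:
  assumes "rat_padic_Cauchy CARD('a) X"
  shows "- padic_of_seq X = (padic_of_seq (\<lambda>n. - X n) :: 'a padic)"
proof -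
  note p = prime_card[where 'a='a]
  show ?thesis unfolding uminus_padic_def
    using rat_padic_null_minus[OF p rat_padic_null_padic_rep_of_seq[OF assms(1)]]
    by (subst padic_of_seq_eq_iff) (auto intro!: rat_padic_Cauchy_minus p padic_rep assms simp: algebra_simps)
qed

lemma padic_of_seq_diff:
  assumes "rat_padic_Cauchy CARD('a) X" "rat_padic_Cauchy CARD('a) Y"
  shows "padic_of_seq X - padic_of_seq Y = (padic_of_seq (\<lambda>n. X n - Y n) :: 'a padic)"
  unfolding minus_padic_def using assms prime_card[where 'a='a]
  by (simp add: padic_of_seq_add padic_of_seq_minus rat_padic_Cauchy_minus)

lemma padic_of_seq_mult:
  assumes "rat_padic_Cauchy CARD('a) X" "rat_padic_Cauchy CARD('a) Y"
  shows "padic_of_seq X * padic_of_seq Y = (padic_of_seq (\<lambda>n. X n * Y n) :: 'a padic)"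
proof -
  note p = prime_card[where 'a='a]
  show ?thesis unfolding times_padic_def
    using rat_padic_null_mult_diff[OF p padic_rep(1) assms(2) rat_padic_null_padic_rep_of_seq[OF assms(1)]
        rat_padic_null_padic_rep_of_seq[OF assms(2)]]
    by (subst padic_of_seq_eq_iff) (auto intro!: rat_padic_Cauchy_mult p padic_rep assms)
qed

lemma padic_of_seq_eq_0_iff:
  assumes "rat_padic_Cauchy CARD('a) X"
  shows "padic_of_seq X = (0 :: 'a padic) \<longleftrightarrow> rat_padic_null CARD('a) X"
  unfolding zero_padic_def
  using padic_of_seq_eq_iff[OF assms rat_padic_Cauchy_const[OF prime_card]] by simp

instance
proof
  note p = prime_card[where 'a='a]
  note [simp] = padic_of_seq_add padic_of_seq_minus padic_of_seq_diff padic_of_seq_mult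
    rat_padic_Cauchy_const[OF p] rat_padic_Cauchy_add[OF p] rat_padic_Cauchy_minus[OF p] rat_padic_Cauchy_mult[OF p]
  fix x y z :: "'a padic"
  obtain X where X [simp]: "rat_padic_Cauchy CARD('a) X" "x = padic_of_seq X" by (rule padic_cases)
  obtain Y where Y [simp]: "rat_padic_Cauchy CARD('a) Y" "y = padic_of_seq Y" by (rule padic_cases)
  obtain Z where Z [simp]: "rat_padic_Cauchy CARD('a) Z" "z = padic_of_seq Z" by (rule padic_cases)
  show "x + y + z = x + (y + z)" "x + y = y + x" "x * y * z = x * (y * z)" "x * y = y * x"
    "(x + y) * z = x * z + y * z"
    by (simp_all add: algebra_simps)
  show "0 + x = x" "1 * x = x" by (simp_all add: zero_padic_def one_padic_def)
  show "- x + x = 0" by (simp add: zero_padic_def)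
  show "x - y = x + - y" by (simp add: minus_padic_def)
  show "x div y = x * inverse y" by (simp add: divide_padic_def)
  show "inverse (0 :: 'a padic) = 0" by (simp add: inverse_padic_def)
  show "(0 :: 'a padic) \<noteq> 1"
    using padic_of_seq_eq_0_iff[of "\<lambda>n. 1"]
    by (auto simp: one_padic_def rat_padic_null_def rat_padic_abs_1[OF p] LIMSEQ_const_iff)
  assume nz: "x \<noteq> 0"
  let ?R = "padic_rep x"
  have R: "rat_padic_Cauchy CARD('a) ?R" "\<not> rat_padic_null CARD('a) ?R"
    using padic_rep[of x] nz padic_of_seq_eq_0_iff[of ?R] by auto
  obtain b N where b: "b > 0" "\<And>n. n \<ge> N \<Longrightarrow> rat_padic_abs CARD('a) (?R n) > b"
    using rat_padic_Cauchy_not_null[OF p R] by metis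
  have ev: "\<forall>\<^sub>F n in sequentially. rat_padic_abs CARD('a) (inverse (?R n) * ?R n - 1) = 0"
    unfolding eventually_sequentially
  proof (intro exI allI impI)
    fix n assume "n \<ge> N"
    from b(2)[OF this] b(1) have "?R n \<noteq> 0" by (auto simp: rat_padic_abs_0[OF p])
    thus "rat_padic_abs CARD('a) (inverse (?R n) * ?R n - 1) = 0" by (simp add: rat_padic_abs_0[OF p])
  qed
  have "inverse x * x = padic_of_seq (\<lambda>n. inverse (?R n)) * padic_of_seq ?R"
    using nz by (simp add: inverse_padic_def padic_rep(2) del: X Y Z)
  also have "\<dots> = padic_of_seq (\<lambda>n. inverse (?R n) * ?R n)"
    using R by (intro padic_of_seq_mult rat_padic_Cauchy_inverse p) auto
  also have "\<dots> = 1" unfolding one_padic_def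
    using R tendsto_eventually[OF ev]
    by (subst padic_of_seq_eq_iff) (auto intro!: rat_padic_Cauchy_mult rat_padic_Cauchy_inverse rat_padic_Cauchy_const p simp: rat_padic_null_def)
  finally show "inverse x * x = 1" .
qed

end

definition padic_abs :: "'p::prime_card padic \<Rightarrow> real" where
  "padic_abs x = lim (\<lambda>n. rat_padic_abs CARD('p) (padic_rep x n))"

lemma tendsto_padic_abs:
  assumes "rat_padic_Cauchy CARD('p::prime_card) X"
  shows "(\<lambda>n. rat_padic_abs CARD('p) (X n)) \<longlonglongrightarrow> padic_abs (padic_of_seq X :: 'p padic)"
proof -
  let ?p = "CARD('p)"
  let ?x = "padic_of_seq X :: 'p padic"
  note p = prime_card[where 'a='p]
  have 1: "(\<lambda>n. rat_padic_abs ?p (padic_rep ?x n)) \<longlonglongrightarrow> padic_abs ?x"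
    using rat_padic_Cauchy_abs_converges[OF p padic_rep(1)] unfolding padic_abs_def
    by (simp add: convergent_LIMSEQ_iff)
  have 2: "(\<lambda>n. rat_padic_abs ?p (padic_rep ?x n - X n)) \<longlonglongrightarrow> 0"
    using rat_padic_null_padic_rep_of_seq[OF assms] by (simp add: rat_padic_null_def)
  have "(\<lambda>n. rat_padic_abs ?p (X n) - rat_padic_abs ?p (padic_rep ?x n)) \<longlonglongrightarrow> 0"
    by (rule Lim_null_comparison[OF always_eventually 2])
       (use rat_padic_abs_diff_triangle[OF p] rat_padic_abs_diff_commute[OF p] in simp)
  from tendsto_add[OF 1 this] show ?thesis by simp
qed

lemma padic_abs_eqI:
  assumes "rat_padic_Cauchy CARD('p::prime_card) X"
    "(\<lambda>n. rat_padic_abs CARD('p) (X n)) \<longlonglongrightarrow> L"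
  shows "padic_abs (padic_of_seq X :: 'p padic) = L"
  using LIMSEQ_unique tendsto_padic_abs[OF assms(1)] assms(2) by blast

lemma padic_abs_nonneg [simp]: "0 \<le> padic_abs (x :: 'p::prime_card padic)"
proof -
  obtain X where X: "rat_padic_Cauchy CARD('p) X" "x = padic_of_seq X" by (rule padic_cases)
  show ?thesis unfolding X(2)
    by (rule LIMSEQ_le_const[OF tendsto_padic_abs[OF X(1)]])
       (auto intro!: rat_padic_abs_nonneg prime_card)
qed

lemma padic_abs_eq_0_iff [simp]: "padic_abs (x :: 'p::prime_card padic) = 0 \<longleftrightarrow> x = 0"
proof -
  obtain X where X: "rat_padic_Cauchy CARD('p) X" "x = padic_of_seq X" by (rule padic_cases)
  show ?thesis unfolding X(2) padic_of_seq_eq_0_iff[OF X(1)] rat_padic_null_def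
    using tendsto_padic_abs[OF X(1)] padic_abs_eqI[OF X(1), of 0] by auto
qed

lemma padic_abs_0 [simp]: "padic_abs 0 = 0"
  by simp

lemma padic_abs_mult: "padic_abs (x * y :: 'p::prime_card padic) = padic_abs x * padic_abs y"
proof -
  note p = prime_card[where 'a='p]
  obtain X where X: "rat_padic_Cauchy CARD('p) X" "x = padic_of_seq X" by (rule padic_cases)
  obtain Y where Y: "rat_padic_Cauchy CARD('p) Y" "y = padic_of_seq Y" by (rule padic_cases)
  show ?thesis
    using tendsto_mult[OF tendsto_padic_abs[OF X(1)] tendsto_padic_abs[OF Y(1)]]
    unfolding X(2) Y(2) padic_of_seq_mult[OF X(1) Y(1)]
    by (intro padic_abs_eqI rat_padic_Cauchy_mult p X Y) (simp add: rat_padic_abs_mult[OF p])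
qed

lemma padic_abs_minus [simp]: "padic_abs (- x :: 'p::prime_card padic) = padic_abs x"
proof -
  note p = prime_card[where 'a='p]
  obtain X where X: "rat_padic_Cauchy CARD('p) X" "x = padic_of_seq X" by (rule padic_cases)
  show ?thesis
    using tendsto_padic_abs[OF X(1)]
    unfolding X(2) padic_of_seq_minus[OF X(1)]
    by (intro padic_abs_eqI rat_padic_Cauchy_minus p X) (simp add: rat_padic_abs_minus[OF p])
qed

lemma padic_abs_diff_commute: "padic_abs (x - y :: 'p::prime_card padic) = padic_abs (y - x)"
  by (metis minus_diff_eq padic_abs_minus)

lemma padic_abs_ultra: "padic_abs (x + y :: 'p::prime_card padic) \<le> max (padic_abs x) (padic_abs y)"
proof -
  note p = prime_card[where 'a='p]
  obtain X where X: "rat_padic_Cauchy CARD('p) X" "x = padic_of_seq X" by (rule padic_cases)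
  obtain Y where Y: "rat_padic_Cauchy CARD('p) Y" "y = padic_of_seq Y" by (rule padic_cases)
  show ?thesis
    unfolding X(2) Y(2) padic_of_seq_add[OF X(1) Y(1)]
    by (rule LIMSEQ_le[OF tendsto_padic_abs[OF rat_padic_Cauchy_add[OF p X(1) Y(1)]]
        tendsto_max[OF tendsto_padic_abs[OF X(1)] tendsto_padic_abs[OF Y(1)]]])
       (auto intro: rat_padic_abs_ultra[OF p])
qed

lemma padic_abs_ultra_diff:
  "padic_abs (x - z :: 'p::prime_card padic) \<le> max (padic_abs (x - y)) (padic_abs (y - z))"
  using padic_abs_ultra[of "x - y" "y - z"] by simp

lemma padic_abs_1 [simp]: "padic_abs (1 :: 'p::prime_card padic) = 1"
  using padic_abs_mult[of 1 "1 :: 'p padic"] by simp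

lemma padic_abs_inverse: "padic_abs (inverse x :: 'p::prime_card padic) = inverse (padic_abs x)"
proof (cases "x = 0")
  case False
  hence "padic_abs x * padic_abs (inverse x) = 1"
    using padic_abs_mult[of x "inverse x"] by simp
  thus ?thesis by (metis inverse_unique)
qed auto

lemma padic_abs_divide: "padic_abs (x / y :: 'p::prime_card padic) = padic_abs x / padic_abs y"
  by (simp add: divide_inverse padic_abs_mult padic_abs_inverse)

text \<open>The metric is |x - y|, so the ball B_r(a) of the p-adic absolute value is the library's
  \<^term>\<open>cball a r\<close>.\<close>

instantiation padic :: (prime_card) metric_space
begin

definition dist_padic :: "'a padic \<Rightarrow> 'a padic \<Rightarrow> real" where
  "dist_padic x y = padic_abs (x - y)"
definition uniformity_padic :: "('a padic \<times> 'a padic) filter" where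
  "uniformity_padic = (INF e\<in>{0<..}. principal {(x, y). dist x y < e})"
definition open_padic :: "'a padic set \<Rightarrow> bool" where
  "open_padic U \<longleftrightarrow> (\<forall>x\<in>U. eventually (\<lambda>(x', y). x' = x \<longrightarrow> y \<in> U) uniformity)"

instance
proof
  fix x y z :: "'a padic"
  show "dist x y = 0 \<longleftrightarrow> x = y" by (simp add: dist_padic_def)
  show "dist x y \<le> dist x z + dist y z"
    using padic_abs_ultra_diff[of x y z] padic_abs_nonneg[of "x - z"] padic_abs_nonneg[of "y - z"]
      padic_abs_diff_commute[of y z]
    unfolding dist_padic_def by linarith
qed (auto simp: uniformity_padic_def open_padic_def)

end

lemma of_nat_padic: "of_nat n = (padic_of_seq (\<lambda>_. of_nat n) :: 'p::prime_card padic)"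
  by (induction n)
     (simp_all add: zero_padic_def one_padic_def padic_of_seq_add rat_padic_Cauchy_const[OF prime_card])

instance padic :: (prime_card) field_char_0
proof
  note p = prime_card[where 'a='a]
  show "inj (of_nat :: nat \<Rightarrow> 'a padic)"
    by (rule injI)
       (simp add: of_nat_padic padic_of_seq_eq_iff rat_padic_Cauchy_const[OF p] rat_padic_null_def
          LIMSEQ_const_iff rat_padic_abs_eq_0[OF p])
qed

lemma of_int_padic: "of_int n = (padic_of_seq (\<lambda>_. of_int n) :: 'p::prime_card padic)"
  by (cases n rule: int_diff_cases)
     (simp add: of_nat_padic padic_of_seq_diff rat_padic_Cauchy_const[OF prime_card])

lemma of_rat_padic: "of_rat q = (padic_of_seq (\<lambda>_. q) :: 'p::prime_card padic)"
proof -
  obtain a b where q: "b \<noteq> 0" "q = of_int a / of_int b" by (rule rat_frac_cases[OF prime_card])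
  have "padic_of_seq (\<lambda>_. q) * of_int b = (of_int a :: 'p padic)"
    using q by (simp add: of_int_padic padic_of_seq_mult rat_padic_Cauchy_const[OF prime_card])
  hence "padic_of_seq (\<lambda>_. q) = (of_int a / of_int b :: 'p padic)"
    using q(1) by (simp add: nonzero_eq_divide_eq)
  also have "\<dots> = of_rat q" by (simp add: q(2) of_rat_divide)
  finally show ?thesis by simp
qed

lemma padic_abs_of_rat: "padic_abs (of_rat q :: 'p::prime_card padic) = rat_padic_abs CARD('p) q"
  unfolding of_rat_padic by (rule padic_abs_eqI) (auto intro: rat_padic_Cauchy_const prime_card)

lemma dist_padic_of_seq_le:
  fixes X :: "nat \<Rightarrow> rat"
  assumes X: "rat_padic_Cauchy CARD('p::prime_card) X"
    and N: "\<And>m. m \<ge> N \<Longrightarrow> rat_padic_abs CARD('p) (X m - q) \<le> e"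
  shows "dist (padic_of_seq X :: 'p padic) (of_rat q) \<le> e"
proof -
  note p = prime_card[where 'a='p]
  have C: "rat_padic_Cauchy CARD('p) (\<lambda>n. X n - q)"
    by (rule rat_padic_Cauchy_diff[OF p X rat_padic_Cauchy_const[OF p]])
  have "dist (padic_of_seq X :: 'p padic) (of_rat q) = padic_abs (padic_of_seq (\<lambda>n. X n - q) :: 'p padic)"
    by (simp add: dist_padic_def of_rat_padic padic_of_seq_diff X rat_padic_Cauchy_const[OF p])
  also have "\<dots> \<le> e"
    by (rule LIMSEQ_le_const2[OF tendsto_padic_abs[OF C]]) (use N in blast)
  finally show ?thesis .
qed

lemma padic_of_rat_dense:
  fixes x :: "'p::prime_card padic"
  assumes "e > 0"
  obtains q where "dist x (of_rat q) < e"
proof -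
  obtain X where X: "rat_padic_Cauchy CARD('p) X" "x = padic_of_seq X" by (rule padic_cases)
  have "e / 2 > 0" using assms by simp
  then obtain N where N: "\<And>m n. m \<ge> N \<Longrightarrow> n \<ge> N \<Longrightarrow> rat_padic_abs CARD('p) (X m - X n) < e / 2"
    using X(1) unfolding rat_padic_Cauchy_def by meson
  have "dist x (of_rat (X N)) \<le> e / 2"
    unfolding X(2) by (rule dist_padic_of_seq_le[OF X(1), of N]) (use N[of _ N] in \<open>force\<close>)
  thus ?thesis using that[of "X N"] assms by simp
qed

lemma padic_abs_range:
  fixes x :: "'p::prime_card padic"
  assumes "x \<noteq> 0"
  obtains k where "padic_abs x = real CARD('p) powi k"
proof -
  have "padic_abs x > 0" using assms by (simp add: less_le)
  then obtain q where q: "padic_abs (x - of_rat q) < padic_abs x"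
    using padic_of_rat_dense[of "padic_abs x" x] by (auto simp: dist_padic_def)
  have "padic_abs x \<le> max (padic_abs (x - of_rat q)) (padic_abs (of_rat q :: 'p padic))"
    using padic_abs_ultra[of "x - of_rat q" "of_rat q"] by simp
  moreover have "padic_abs (of_rat q :: 'p padic) \<le> max (padic_abs (of_rat q - x)) (padic_abs x)"
    using padic_abs_ultra[of "of_rat q - x" x] by simp
  ultimately have eq: "padic_abs x = padic_abs (of_rat q :: 'p padic)"
    using q padic_abs_diff_commute[of x "of_rat q"] by auto
  hence "q \<noteq> 0" using assms by auto
  then obtain k where "rat_padic_abs CARD('p) q = real CARD('p) powi k"
    using rat_padic_abs_range[OF prime_card] by blast
  with eq show ?thesis using that by (simp add: padic_abs_of_rat)
qed

instance padic :: (prime_card) complete_space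
proof
  fix X :: "nat \<Rightarrow> 'a padic"
  assume C: "Cauchy X"
  have "\<forall>n. \<exists>q. dist (X n) (of_rat q) < inverse (real (Suc n))"
  proof
    fix n
    show "\<exists>q. dist (X n) (of_rat q) < inverse (real (Suc n))"
      by (rule padic_of_rat_dense[of "inverse (real (Suc n))" "X n"]) auto
  qed
  then obtain q where q: "\<And>n. dist (X n) (of_rat (q n)) < inverse (real (Suc n))" by metis
  have null: "(\<lambda>n. dist (X n) (of_rat (q n))) \<longlonglongrightarrow> 0"
    by (rule tendsto_sandwich[OF always_eventually always_eventually tendsto_const LIMSEQ_inverse_real_of_nat])
       (use q less_imp_le in auto)
  have qC: "rat_padic_Cauchy CARD('a) q" unfolding rat_padic_Cauchy_def
  proof (intro allI impI)
    fix e :: real assume e: "e > 0"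
    hence e3: "e / 3 > 0" by simp
    obtain M where M: "\<And>m n. m \<ge> M \<Longrightarrow> n \<ge> M \<Longrightarrow> dist (X m) (X n) < e / 3"
      using C e3 unfolding Cauchy_def by meson
    obtain N where N: "\<And>n. n \<ge> N \<Longrightarrow> dist (X n) (of_rat (q n)) < e / 3"
      using order_tendstoD(2)[OF null e3] by (auto simp: eventually_sequentially)
    have "rat_padic_abs CARD('a) (q m - q n) < e" if "m \<ge> max M N" "n \<ge> max M N" for m n
    proof -
      have "rat_padic_abs CARD('a) (q m - q n) = dist (of_rat (q m) :: 'a padic) (of_rat (q n))"
        by (simp add: dist_padic_def flip: padic_abs_of_rat of_rat_diff)
      also have "\<dots> \<le> dist (X m) (of_rat (q m)) + dist (X m) (of_rat (q n))"
        by (rule dist_triangle3)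
      also have "\<dots> \<le> dist (X m) (of_rat (q m)) + (dist (X m) (X n) + dist (X n) (of_rat (q n)))"
        by (intro add_left_mono dist_triangle)
      also have "\<dots> < e" using M[of m n] N[of m] N[of n] that by simp
      finally show ?thesis .
    qed
    thus "\<exists>N. \<forall>m\<ge>N. \<forall>n\<ge>N. rat_padic_abs CARD('a) (q m - q n) < e" by blast
  qed
  define L :: "'a padic" where "L = padic_of_seq q"
  have "X \<longlonglongrightarrow> L"
  proof (rule metric_LIMSEQ_I)
    fix e :: real assume e: "e > 0"
    hence e2: "e / 2 > 0" and e3: "e / 3 > 0" by simp_all
    obtain M where M: "\<And>m n. m \<ge> M \<Longrightarrow> n \<ge> M \<Longrightarrow> rat_padic_abs CARD('a) (q m - q n) < e / 3"
      using qC e3 unfolding rat_padic_Cauchy_def by meson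
    obtain N where N: "\<And>n. n \<ge> N \<Longrightarrow> dist (X n) (of_rat (q n)) < e / 2"
      using order_tendstoD(2)[OF null e2] by (auto simp: eventually_sequentially)
    have "dist (X n) L < e" if "n \<ge> max M N" for n
    proof -
      have "dist L (of_rat (q n)) \<le> e / 3" unfolding L_def
        by (rule dist_padic_of_seq_le[OF qC, of M]) (use M[of _ n] that in \<open>force\<close>)
      with dist_triangle2[of "X n" L "of_rat (q n)"] N[of n] that e show ?thesis by simp
    qed
    thus "\<exists>no. \<forall>n\<ge>no. dist (X n) L < e" by blast
  qed
  thus "convergent X" by (auto simp: convergent_def)
qed

lemma padic_ultra_mem:
  fixes x y z :: "'p::prime_card padic"
  shows "dist x y \<le> r \<Longrightarrow> dist y z \<le> r \<Longrightarrow> dist x z \<le> r"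
  using padic_abs_ultra_diff[of x z y] unfolding dist_padic_def by linarith

lemma padic_cball_eq:
  fixes a b :: "'p::prime_card padic"
  assumes "dist a b \<le> r"
  shows "cball a r = cball b r"
  using assms padic_ultra_mem[of _ _ r] by (fastforce simp: dist_commute)

lemma padic_CARD_gt_1: "real CARD('p::prime_card) > 1"
  using prime_gt_1_nat[OF prime_card[where 'a='p]] by simp

lemma padic_abs_lt_imp_le:
  fixes x :: "'p::prime_card padic"
  assumes "padic_abs x < real CARD('p) powi (k + 1)"
  shows "padic_abs x \<le> real CARD('p) powi k"
proof (cases "x = 0")
  case False
  then obtain l where l: "padic_abs x = real CARD('p) powi l" by (rule padic_abs_range)
  have "\<not> l \<ge> k + 1"
    using power_int_increasing[of "k + 1" l "real CARD('p)"] assms l padic_CARD_gt_1[where 'p='p] by auto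
  thus ?thesis unfolding l using padic_CARD_gt_1[where 'p='p] by (intro power_int_increasing) auto
qed auto

lemma padic_residue:
  fixes y :: "'p::prime_card padic"
  assumes "padic_abs y \<le> 1"
  obtains d where "d < CARD('p)" "padic_abs (y - of_nat d) < 1"
proof -
  let ?p = "CARD('p)"
  note p = prime_card[where 'a='p]
  obtain q where q: "dist y (of_rat q) < 1" using padic_of_rat_dense[of 1 y] by auto
  have "padic_abs (of_rat q :: 'p padic) \<le> 1"
    using padic_abs_ultra[of "of_rat q - y" y] q assms
    by (simp add: dist_padic_def padic_abs_diff_commute[of y])
  hence q1: "rat_padic_abs ?p q \<le> 1" by (simp add: padic_abs_of_rat)
  obtain a b where ab: "quotient_of q = (a, b)" by fastforce
  have b: "b > 0" and cop: "coprime a b" and qab: "q = of_int a / of_int b"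
    using quotient_of_denom_pos[OF ab] quotient_of_coprime[OF ab] quotient_of_div[OF ab] by auto
  have "rat_padic_abs ?p q * rat_padic_abs ?p (of_int b) = rat_padic_abs ?p (of_int a)"
    using b qab by (simp flip: rat_padic_abs_mult[OF p])
  hence le: "rat_padic_abs ?p (of_int a) \<le> rat_padic_abs ?p (of_int b)"
    using q1 mult_right_mono[OF q1, of "rat_padic_abs ?p (of_int b)"] rat_padic_abs_nonneg[OF p] by simp
  have nb: "\<not> int ?p dvd b"
  proof
    assume pb: "int ?p dvd b"
    hence "int ?p dvd a" using le rat_padic_abs_int_lt_1_iff[OF p] by (meson le_less_trans)
    with pb cop have "is_unit (int ?p)" by (meson coprime_common_divisor)
    thus False using padic_CARD_gt_1[where 'p='p] by simp
  qed
  hence b1: "rat_padic_abs ?p (of_int b) = 1"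
    using rat_padic_abs_int_lt_1_iff[OF p, of b] rat_padic_abs_int_le_1[OF p, of b] by linarith
  have "coprime b (int ?p)"
    using nb p by (metis coprime_commute prime_imp_coprime prime_nat_int_transfer)
  then obtain c v where "c * b + v * int ?p = 1"
    using bezout_int[of b "int ?p"] by auto
  hence "b * c - 1 = int ?p * (- v)" by (simp add: algebra_simps)
  hence c: "int ?p dvd b * c - 1" by (metis dvd_triv_left)
  define d where "d = nat ((a * c) mod int ?p)"
  have pp: "int ?p > 0" using padic_CARD_gt_1[where 'p='p] by linarith
  have d: "int d = (a * c) mod int ?p" using pp by (simp add: d_def)
  have dlt: "d < ?p" using d pp by (metis of_nat_less_iff pos_mod_bound)
  have 1: "int ?p dvd a * c - int d" by (simp add: d minus_mod_eq_mult_div)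
  have "int ?p dvd (a * c - int d) * b - a * (b * c - 1)"
    by (rule dvd_diff[OF dvd_mult2[OF 1] dvd_mult[OF c]])
  hence pd: "int ?p dvd a - int d * b" by (simp add: algebra_simps)
  have "(q - of_nat d) * of_int b = of_int (a - int d * b)"
    using b by (simp add: qab field_simps)
  hence "rat_padic_abs ?p (q - of_nat d) * 1 = rat_padic_abs ?p (of_int (a - int d * b))"
    by (metis b1 rat_padic_abs_mult[OF p])
  hence "rat_padic_abs ?p (q - of_nat d) < 1"
    using pd by (simp only: mult_1_right rat_padic_abs_int_lt_1_iff[OF p])
  hence "padic_abs (of_rat q - of_nat d :: 'p padic) < 1"
    by (simp flip: padic_abs_of_rat add: of_rat_diff)
  hence "padic_abs (y - of_nat d) < 1"
    using padic_abs_ultra[of "y - of_rat q" "of_rat q - of_nat d"] q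
    by (simp add: dist_padic_def)
  with dlt that show ?thesis by blast
qed

text \<open>The existence of Haar measure is shown by taking the image of Lebesgue measure on the half line under the map
  that reads the base-p digits of a real number in reverse order.  The function below is the digit
  reversal (van der Corput) map on natural numbers.\<close>

fun digit_rev :: "nat \<Rightarrow> nat \<Rightarrow> rat" where
  "digit_rev p n = (if n = 0 \<or> p \<le> 1 then 0
     else (of_nat (n mod p) + digit_rev p (n div p)) / of_nat p)"

declare digit_rev.simps [simp del]

text \<open>If t is non-negative and d(i) is its base-p digit of weight p^(-i-1), for integers i of either
  sign, then this is the sum of d(i) p^i over i < k.\<close>

definition digit_approx :: "nat \<Rightarrow> real \<Rightarrow> int \<Rightarrow> rat" where
  "digit_approx p t k = of_nat p powi k * digit_rev p (nat \<lfloor>t * real p powi k\<rfloor>)"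

context
  fixes p :: nat
  assumes p: "prime p"
begin

lemma digit_rev_rec: "digit_rev p n = (of_nat (n mod p) + digit_rev p (n div p)) / of_nat p"
  using prime_gt_1_nat[OF p] by (cases "n = 0") (simp_all add: digit_rev.simps)

lemma digit_rev_unique:
  "rat_padic_abs p (digit_rev p i - digit_rev p j) \<le> 1 \<Longrightarrow> i = j"
proof (induction "i + j" arbitrary: i j rule: less_induct)
  case less
  have p1: "p > 1" using prime_gt_1_nat[OF p] .
  show ?case
  proof (cases "i = 0 \<and> j = 0")
    case False
    define u :: int where "u = int (i mod p) - int (j mod p)"
    let ?v = "digit_rev p (i div p) - digit_rev p (j div p)"
    have "of_nat p * (digit_rev p i - digit_rev p j) = of_int u + ?v"
      using p1 by (simp add: digit_rev_rec[of i] digit_rev_rec[of j] u_def field_simps)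
    hence "rat_padic_abs p (of_int u + ?v) = rat_padic_abs p (digit_rev p i - digit_rev p j) / real p"
      by (metis rat_padic_abs_mult[OF p] rat_padic_abs_p[OF p] mult.left_neutral times_divide_eq_left)
    also have "\<dots> \<le> 1 / real p" using less.prems p1 by (simp add: divide_right_mono)
    finally have uv: "rat_padic_abs p (of_int u + ?v) \<le> 1 / real p" .
    have p1': "1 / real p < 1" using p1 by simp
    have "rat_padic_abs p ?v \<le> max (rat_padic_abs p (of_int u + ?v)) (rat_padic_abs p (- of_int u))"
      using rat_padic_abs_ultra[OF p, of "of_int u + ?v" "- of_int u"] by simp
    hence "rat_padic_abs p ?v \<le> 1"
      using uv p1' rat_padic_abs_int_le_1[OF p, of u] by (simp add: rat_padic_abs_minus[OF p])
    moreover have "i div p + j div p < i + j"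
    proof (cases "i = 0")
      case True
      thus ?thesis using False p1 by simp
    next
      case False
      thus ?thesis using p1 by (meson add_less_le_mono bot_nat_0.not_eq_extremum div_le_dividend div_less_dividend)
    qed
    ultimately have d: "i div p = j div p" using less.hyps by blast
    hence "rat_padic_abs p (of_int u) < 1" using uv p1' by simp
    hence "int p dvd u" by (simp only: rat_padic_abs_int_lt_1_iff[OF p])
    hence "int p dvd int (i mod p) - int (j mod p)" by (simp only: u_def)
    hence "int (i mod p) mod int p = int (j mod p) mod int p" by (simp add: mod_eq_dvd_iff)
    hence "i mod p = j mod p" by (simp flip: of_nat_mod)
    with d show ?thesis by (metis div_mult_mod_eq)
  qed auto
qed

lemma rat_padic_abs_power_int: "rat_padic_abs p (of_nat p powi k) = real p powi (- k)"
proof -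
  have n: "rat_padic_abs p (of_nat p ^ n) = inverse (real p ^ n)" for n
    by (induction n)
       (simp_all add: rat_padic_abs_1[OF p] rat_padic_abs_mult[OF p] rat_padic_abs_p[OF p] divide_inverse)
  show ?thesis
    by (cases "k \<ge> 0")
       (simp_all add: power_int_def n rat_padic_abs_inverse[OF p] power_inverse)
qed

lemma digit_approx_step:
  "rat_padic_abs p (digit_approx p t (k + 1) - digit_approx p t k) \<le> real p powi (- k)"
proof -
  have p1: "p > 1" using prime_gt_1_nat[OF p] .
  define j where "j = nat \<lfloor>t * real p powi (k + 1)\<rfloor>"
  have "t * real p powi k = (t * real p powi (k + 1)) / real_of_int (int p)"
    using p1 by (simp add: power_int_add)
  hence "\<lfloor>t * real p powi k\<rfloor> = \<lfloor>t * real p powi (k + 1)\<rfloor> div int p"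
    by (simp only: floor_divide_real_eq_div[of "int p"] of_nat_0_le_iff)
  hence jd: "nat \<lfloor>t * real p powi k\<rfloor> = j div p"
    using p1 by (simp add: j_def nat_div_distrib')
  have "digit_approx p t (k + 1) = of_nat p powi k * (of_nat (j mod p) + digit_rev p (j div p))"
    unfolding digit_approx_def j_def[symmetric] digit_rev_rec[of j]
    using p1 by (simp add: power_int_add)
  hence "digit_approx p t (k + 1) - digit_approx p t k = of_nat p powi k * of_int (int (j mod p))"
    by (simp add: digit_approx_def jd algebra_simps)
  thus ?thesis
    using rat_padic_abs_int_le_1[OF p, of "int (j mod p)"] p1
    by (simp only: rat_padic_abs_mult[OF p] rat_padic_abs_power_int)
       (simp add: mult_left_le)
qed

lemma digit_approx_le:
  assumes "k \<le> l"
  shows "rat_padic_abs p (digit_approx p t l - digit_approx p t k) \<le> real p powi (- k)"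
  using assms
proof (induction l rule: int_ge_induct)
  case base
  thus ?case using p by (simp add: rat_padic_abs_0)
next
  case (step l)
  have "real p powi (- l) \<le> real p powi (- k)"
    using step.hyps padic_base_gt_1[OF p] by (intro power_int_increasing) auto
  with step.IH digit_approx_step[of t l]
    rat_padic_abs_ultra[OF p, of "digit_approx p t (l + 1) - digit_approx p t l" "digit_approx p t l - digit_approx p t k"]
  show ?case by simp
qed

lemma rat_padic_Cauchy_digit_approx: "rat_padic_Cauchy p (\<lambda>n. digit_approx p t (int n))"
  unfolding rat_padic_Cauchy_def
proof (intro allI impI)
  fix e :: real assume e: "e > 0"
  obtain N where "(1 / real p) ^ N < e"
    using real_arch_pow_inv[OF e, of "1 / real p"] padic_base_gt_1[OF p] by auto
  hence N: "real p powi (- int N) < e"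
    by (simp add: power_int_minus power_one_over field_simps)
  have "rat_padic_abs p (digit_approx p t (int m) - digit_approx p t (int n)) < e" if "m \<ge> N" "n \<ge> N" for m n
    using digit_approx_le[of "int N" "int m" t] digit_approx_le[of "int N" "int n" t] that N
      rat_padic_abs_ultra[OF p, of "digit_approx p t (int m) - digit_approx p t (int N)"
        "digit_approx p t (int N) - digit_approx p t (int n)"]
      rat_padic_abs_diff_commute[OF p, of "digit_approx p t (int n)"]
    by simp
  thus "\<exists>N. \<forall>m\<ge>N. \<forall>n\<ge>N. rat_padic_abs p (digit_approx p t (int m) - digit_approx p t (int n)) < e"
    by blast
qed

end

lemma of_rat_p_powi: "of_rat (of_nat n powi k) = (of_nat n powi k :: 'a::field_char_0)"
  by (simp add: power_int_def of_rat_power of_rat_inverse)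

lemma padic_abs_p_powi: "padic_abs (of_nat CARD('p) powi k :: 'p::prime_card padic) = real CARD('p) powi (- k)"
  unfolding of_rat_p_powi[where 'a = "'p padic", symmetric]
  by (simp add: padic_abs_of_rat rat_padic_abs_power_int[OF prime_card])

lemma digit_rev_exists_unit:
  fixes x :: "'p::prime_card padic"
  shows "padic_abs x \<le> real CARD('p) ^ n \<Longrightarrow> \<exists>j. padic_abs (x - of_rat (digit_rev CARD('p) j)) \<le> 1"
proof (induction n arbitrary: x)
  case 0
  thus ?case by (intro exI[of _ 0]) (simp add: digit_rev.simps)
next
  case (Suc n)
  let ?p = "CARD('p)"
  note p = prime_card[where 'a='p]
  have p1: "real ?p > 1" by (rule padic_CARD_gt_1)
  have ap: "padic_abs (of_nat ?p :: 'p padic) = 1 / real ?p"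
    using padic_abs_p_powi[where 'p='p, of 1] by (simp add: power_int_minus inverse_eq_divide)
  have "padic_abs (of_nat ?p * x) \<le> real ?p ^ n"
    using Suc.prems p1 by (simp add: padic_abs_mult ap field_simps)
  from Suc.IH[OF this] obtain j where
    j: "padic_abs (of_nat ?p * x - of_rat (digit_rev ?p j)) \<le> 1" by blast
  obtain d where d: "d < ?p" "padic_abs (of_nat ?p * x - of_rat (digit_rev ?p j) - of_nat d) < 1"
    using padic_residue[OF j] by blast
  have le: "padic_abs (of_nat ?p * x - of_rat (digit_rev ?p j) - of_nat d) \<le> 1 / real ?p"
    using padic_abs_lt_imp_le[of _ "-1"] d(2) by (simp add: power_int_minus inverse_eq_divide)
  have "digit_rev ?p (?p * j + d) = (of_nat d + digit_rev ?p j) / of_nat ?p"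
    using d(1) digit_rev_rec[OF p, of "?p * j + d"] by simp
  hence eq: "of_rat (digit_rev ?p (?p * j + d)) = (of_nat d + of_rat (digit_rev ?p j)) / (of_nat ?p :: 'p padic)"
    by (simp only: of_rat_divide of_rat_add of_rat_of_nat_eq)
  define w where "w = of_nat ?p * x - of_rat (digit_rev ?p j) - of_nat d"
  have "x - of_rat (digit_rev ?p (?p * j + d)) = w / of_nat ?p"
    unfolding eq w_def by (simp add: field_simps)
  hence "padic_abs (x - of_rat (digit_rev ?p (?p * j + d))) = padic_abs w * real ?p"
    by (simp only: padic_abs_divide ap) simp
  also have "\<dots> \<le> 1"
    using le[folded w_def] p1 by (simp add: field_simps)
  finally have "padic_abs (x - of_rat (digit_rev ?p (?p * j + d))) \<le> 1" .
  thus ?case by blast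
qed

lemma digit_rev_exists:
  fixes x :: "'p::prime_card padic"
  obtains j where "padic_abs (x - of_rat (of_nat CARD('p) powi k * digit_rev CARD('p) j)) \<le> real CARD('p) powi (- k)"
proof -
  let ?p = "CARD('p)"
  let ?y = "x / of_nat ?p powi k"
  obtain n where "padic_abs ?y < real ?p ^ n"
    using real_arch_pow[OF padic_CARD_gt_1[where 'p='p]] by blast
  then obtain j where j: "padic_abs (?y - of_rat (digit_rev ?p j)) \<le> 1"
    using digit_rev_exists_unit[of ?y n] by auto
  have eq: "x - of_rat (of_nat ?p powi k * digit_rev ?p j) = of_nat ?p powi k * (?y - of_rat (digit_rev ?p j))"
    by (simp add: of_rat_mult of_rat_p_powi right_diff_distrib)
  have "padic_abs (x - of_rat (of_nat ?p powi k * digit_rev ?p j)) \<le> real ?p powi (- k)"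
    unfolding eq padic_abs_mult padic_abs_p_powi using j by (simp add: mult_left_le)
  with that show ?thesis by blast
qed

definition padic_of_real :: "real \<Rightarrow> 'p::prime_card padic" where
  "padic_of_real t = padic_of_seq (\<lambda>n. digit_approx CARD('p) t (int n))"

lemma dist_padic_of_real:
  "dist (padic_of_real t) (of_rat (digit_approx CARD('p) t k) :: 'p::prime_card padic)
     \<le> real CARD('p) powi (- k)"
proof -
  note p = prime_card[where 'a='p]
  show ?thesis unfolding padic_of_real_def
    by (rule dist_padic_of_seq_le[OF rat_padic_Cauchy_digit_approx[OF p], of "nat k"])
       (use digit_approx_le[OF p] in auto)
qed

lemma padic_of_real_in_cball_iff:
  fixes a :: "'p::prime_card padic"
  obtains j :: nat where
    "\<And>t. t \<ge> 0 \<Longrightarrow> padic_of_real t \<in> cball a (real CARD('p) powi (- k)) \<longleftrightarrow>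
       t \<in> {real j * real CARD('p) powi (- k) ..< real (Suc j) * real CARD('p) powi (- k)}"
proof -
  let ?p = "CARD('p)"
  note p = prime_card[where 'a='p]
  define r where "r = real ?p powi (- k)"
  have r: "r > 0" using padic_CARD_gt_1[where 'p='p] by (simp add: r_def)
  obtain j where j: "padic_abs (a - of_rat (of_nat ?p powi k * digit_rev ?p j)) \<le> r"
    using digit_rev_exists[of a k] by (auto simp: r_def)
  have "padic_of_real t \<in> cball a r \<longleftrightarrow> t \<in> {real j * r ..< real (Suc j) * r}"
    if t: "t \<ge> 0" for t
  proof -
    define i where "i = nat \<lfloor>t * real ?p powi k\<rfloor>"
    have da: "digit_approx ?p t k = of_nat ?p powi k * digit_rev ?p i"
      by (simp add: digit_approx_def i_def)
    have j': "dist a (of_rat (of_nat ?p powi k * digit_rev ?p j)) \<le> r"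
      using j by (simp add: dist_padic_def)
    have gi: "dist (padic_of_real t) (of_rat (of_nat ?p powi k * digit_rev ?p i) :: 'p padic) \<le> r"
      using dist_padic_of_real[of t k, where 'p='p] by (simp add: da r_def)
    have "padic_of_real t \<in> cball a r \<longleftrightarrow>
      dist (of_rat (of_nat ?p powi k * digit_rev ?p i)) (of_rat (of_nat ?p powi k * digit_rev ?p j) :: 'p padic) \<le> r"
      using padic_cball_eq[OF j'] padic_cball_eq[OF gi] by (metis mem_cball dist_commute)
    also have "\<dots> \<longleftrightarrow> r * rat_padic_abs ?p (digit_rev ?p i - digit_rev ?p j) \<le> r"
      by (simp add: dist_padic_def flip: of_rat_diff right_diff_distrib)
         (simp add: padic_abs_of_rat rat_padic_abs_mult[OF p] rat_padic_abs_power_int[OF p] r_def)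
    also have "\<dots> \<longleftrightarrow> i = j"
      using r digit_rev_unique[OF p, of i j] by (auto simp: rat_padic_abs_0[OF p])
    also have "\<dots> \<longleftrightarrow> \<lfloor>t * real ?p powi k\<rfloor> = int j"
      using t by (auto simp: i_def)
    also have "t * real ?p powi k = t / r"
      by (simp add: r_def power_int_minus field_simps)
    also have "\<lfloor>t / r\<rfloor> = int j \<longleftrightarrow> t \<in> {real j * r ..< real (Suc j) * r}"
      using r by (simp add: floor_eq_iff field_simps)
    finally show ?thesis .
  qed
  thus ?thesis using that by (simp add: r_def)
qed

lemma padic_cball_nested:
  fixes a b :: "'p::prime_card padic"
  assumes "r \<le> s" "cball a r \<inter> cball b s \<noteq> {}"
  shows "cball a r \<inter> cball b s = cball a r"
proof -
  obtain x where x: "dist a x \<le> r" "dist b x \<le> s" using assms(2) by auto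
  have "cball a r = cball x r" "cball b s = cball x s"
    using x by (auto intro!: padic_cball_eq)
  thus ?thesis using assms(1) by auto
qed

lemma padic_powi_lt:
  assumes "e > 0"
  obtains n :: nat where "real CARD('p::prime_card) powi (- int n) < e"
proof -
  obtain n where "(1 / real CARD('p)) ^ n < e"
    using real_arch_pow_inv[OF assms, of "1 / real CARD('p)"] padic_CARD_gt_1[where 'p='p] by auto
  thus ?thesis using that[of n] by (simp add: power_int_minus power_one_over field_simps)
qed

definition padic_balls :: "'p::prime_card padic set set" where
  "padic_balls = insert {} (range (\<lambda>(a, k). cball a (real CARD('p) powi k)))"

lemma Int_stable_padic_balls: "Int_stable (padic_balls :: 'p::prime_card padic set set)"
proof (rule Int_stableI)
  have *: "cball a (real CARD('p) powi k) \<inter> cball b (real CARD('p) powi l) \<in> padic_balls"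
    if "k \<le> l" for a b :: "'p padic" and k l
  proof (cases "cball a (real CARD('p) powi k) \<inter> cball b (real CARD('p) powi l) = {}")
    case False
    have "real CARD('p) powi k \<le> real CARD('p) powi l"
      using that padic_CARD_gt_1[where 'p='p] by (intro power_int_increasing) auto
    from padic_cball_nested[OF this False] show ?thesis by (auto simp: padic_balls_def)
  qed (auto simp: padic_balls_def)
  fix A B :: "'p padic set" assume AB: "A \<in> padic_balls" "B \<in> padic_balls"
  show "A \<inter> B \<in> padic_balls"
  proof (cases "A = {} \<or> B = {}")
    case False
    then obtain a k b l where "A = cball a (real CARD('p) powi k)" "B = cball b (real CARD('p) powi l)"
      using AB by (auto simp: padic_balls_def)
    thus ?thesis using *[of k l a b] *[of l k b a] by (cases "k \<le> l") (auto simp: Int_commute)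
  qed (auto simp: padic_balls_def)
qed

lemma sets_borel_padic: "sets borel = sigma_sets UNIV (padic_balls :: 'p::prime_card padic set set)"
proof (intro equalityI)
  show "sigma_sets UNIV (padic_balls :: 'p padic set set) \<subseteq> sets borel"
    by (rule sets.sigma_sets_subset[where M = borel, simplified])
       (auto simp: padic_balls_def intro: borel_closed)
  have "S \<in> sigma_sets UNIV padic_balls" if S: "open S" for S :: "'p padic set"
  proof -
    let ?b = "\<lambda>(q, n). cball (of_rat q :: 'p padic) (real CARD('p) powi (- int n))"
    let ?I = "{i. ?b i \<subseteq> S}"
    have "S = (\<Union>i\<in>?I. ?b i)"
    proof (intro equalityI subsetI)
      fix x assume "x \<in> S"
      then obtain e where e: "e > 0" "ball x e \<subseteq> S" using S openE by blast
      obtain n :: nat where n: "real CARD('p) powi (- int n) < e"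
        using padic_powi_lt[OF e(1), where 'p='p] by blast
      obtain q where q: "dist x (of_rat q) < real CARD('p) powi (- int n)"
        using padic_of_rat_dense[of "real CARD('p) powi (- int n)" x] padic_CARD_gt_1[where 'p='p]
        by auto
      have "?b (q, n) = cball x (real CARD('p) powi (- int n))"
        using q padic_cball_eq[of x "of_rat q"] by simp
      also have "\<dots> \<subseteq> S" using n e(2) by auto
      finally have "(q, n) \<in> ?I" by simp
      moreover have "x \<in> ?b (q, n)" using q by (simp add: dist_commute)
      ultimately show "x \<in> (\<Union>i\<in>?I. ?b i)" by blast
    qed auto
    also have "\<dots> \<in> sigma_sets UNIV padic_balls"
      by (rule sigma_sets_UNION) (auto simp: padic_balls_def intro: sigma_sets.Basic)
    finally show ?thesis .
  qed
  hence "sigma_sets UNIV {S :: 'p padic set. open S} \<subseteq> sigma_sets UNIV padic_balls"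
    by (intro sigma_sets_mono) auto
  thus "sets borel \<subseteq> sigma_sets UNIV (padic_balls :: 'p padic set set)"
    by (simp add: borel_def)
qed

lemma padic_measure_eqI:
  fixes M N :: "'p::prime_card padic measure"
  assumes "sets M = sets borel" "sets N = sets borel"
    and M: "\<And>a k. emeasure M (cball a (real CARD('p) powi k)) = ennreal (real CARD('p) powi k)"
    and N: "\<And>a k. emeasure N (cball a (real CARD('p) powi k)) = ennreal (real CARD('p) powi k)"
  shows "M = N"
proof (rule measure_eqI_generator_eq[OF Int_stable_padic_balls])
  show "padic_balls \<subseteq> Pow (UNIV :: 'p padic set)" by simp
  show "sets M = sigma_sets UNIV padic_balls" "sets N = sigma_sets UNIV padic_balls"
    using assms by (simp_all add: sets_borel_padic)
  show "emeasure M X = emeasure N X" if "X \<in> padic_balls" for X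
    using that M N by (auto simp: padic_balls_def)
  let ?A = "\<lambda>n. cball (0 :: 'p padic) (real CARD('p) powi int n)"
  show "range ?A \<subseteq> padic_balls"
  proof (rule image_subsetI)
    fix n
    have "?A n = (\<lambda>(a, k). cball a (real CARD('p) powi k)) (0, int n)" by simp
    thus "?A n \<in> padic_balls" unfolding padic_balls_def by (metis insertI2 rangeI)
  qed
  show "(\<Union>n. ?A n) = UNIV"
  proof (intro equalityI subsetI)
    fix x :: "'p padic"
    obtain n where "dist 0 x < real CARD('p) ^ n"
      using real_arch_pow[OF padic_CARD_gt_1[where 'p='p]] by blast
    thus "x \<in> (\<Union>n. ?A n)" by (auto intro!: exI[of _ n])
  qed auto
  show "emeasure M (?A n) \<noteq> \<infinity>" for n by (simp only: M) simp
qed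

text \<open>Translation invariance together with the normalisation that a ball of radius p^k has
  measure p^k.  The measure lives on the Borel sets of the metric topology.\<close>

definition is_padic_haar :: "'p::prime_card padic measure \<Rightarrow> bool" where
  "is_padic_haar M \<longleftrightarrow> sets M = sets borel \<and>
     (\<forall>a. \<forall>A\<in>sets borel. emeasure M ((+) a ` A) = emeasure M A) \<and>
     (\<forall>a k. emeasure M (cball a (real CARD('p) powi k)) = ennreal (real CARD('p) powi k))"

lemma continuous_padic_add: "continuous_on UNIV (\<lambda>x. x + a :: 'p::prime_card padic)"
  unfolding continuous_on_iff by (auto simp: dist_padic_def)

lemma is_padic_haarI:
  fixes M :: "'p::prime_card padic measure"
  assumes sM: "sets M = sets borel"
    and M: "\<And>a k. emeasure M (cball a (real CARD('p) powi k)) = ennreal (real CARD('p) powi k)"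
  shows "is_padic_haar M"
proof -
  have "emeasure M ((+) a ` A) = emeasure M A" if A: "A \<in> sets borel" for a A
  proof -
    have spM: "space M = UNIV" using sets_eq_imp_space_eq[OF sM] by simp
    have me: "(\<lambda>x. x + - a) \<in> measurable M borel"
      using borel_measurable_continuous_onI[OF continuous_padic_add[of "- a"]] sM
      by (simp cong: measurable_cong_sets)
    have vim: "(\<lambda>x. x + - a) -` B = (+) a ` B" for B
    proof (intro equalityI subsetI)
      fix x assume "x \<in> (\<lambda>x. x + - a) -` B"
      hence "x = a + (x + - a)" "x + - a \<in> B" by auto
      thus "x \<in> (+) a ` B" by (rule image_eqI)
    qed auto
    have "distr M borel (\<lambda>x. x + - a) = M"
    proof (rule padic_measure_eqI)
      fix b :: "'p padic" and k
      have "(\<lambda>x. x + - a) -` cball b (real CARD('p) powi k) = cball (b + a) (real CARD('p) powi k)"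
        by (auto simp: dist_padic_def algebra_simps)
      thus "emeasure (distr M borel (\<lambda>x. x + - a)) (cball b (real CARD('p) powi k))
          = ennreal (real CARD('p) powi k)"
        using M spM by (subst emeasure_distr[OF me]) auto
    qed (use sM M in auto)
    hence "emeasure M A = emeasure (distr M borel (\<lambda>x. x + - a)) A" by simp
    also have "\<dots> = emeasure M ((+) a ` A)"
      using A spM by (simp only: emeasure_distr[OF me] vim) simp
    finally show ?thesis by simp
  qed
  thus ?thesis using assms by (simp add: is_padic_haar_def)
qed

lemma ex1_padic_haar: "\<exists>!M :: 'p::prime_card padic measure. is_padic_haar M"
proof (rule ex_ex1I)
  let ?H = "restrict_space lborel {0::real..}"
  let ?g = "padic_of_real :: real \<Rightarrow> 'p padic"
  have vim: "?g -` cball a (real CARD('p) powi k) \<inter> {0..} \<in> sets lborel \<and>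
     emeasure lborel (?g -` cball a (real CARD('p) powi k) \<inter> {0..}) = ennreal (real CARD('p) powi k)"
    for a :: "'p padic" and k
  proof -
    obtain j :: nat where j: "\<And>t. t \<ge> 0 \<Longrightarrow> ?g t \<in> cball a (real CARD('p) powi (- (- k))) \<longleftrightarrow>
       t \<in> {real j * real CARD('p) powi (- (- k)) ..< real (Suc j) * real CARD('p) powi (- (- k))}"
      using padic_of_real_in_cball_iff[of a "- k"] by blast
    define r where "r = real CARD('p) powi k"
    have r: "r > 0" using padic_CARD_gt_1[where 'p='p] by (simp add: r_def)
    have "?g -` cball a r \<inter> {0..} = {real j * r ..< real (Suc j) * r} \<inter> {0..}"
      using j by (auto simp: r_def simp del: mem_cball)
    also have "\<dots> = {real j * r ..< real (Suc j) * r}" using r by (auto intro: order_trans[rotated])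
    finally have *: "?g -` cball a r \<inter> {0..} = {real j * r ..< real (Suc j) * r}" .
    have "real (Suc j) * r - real j * r = r" by (simp add: algebra_simps)
    thus ?thesis using r unfolding r_def[symmetric] * by (simp add: algebra_simps)
  qed
  have me: "?g \<in> measurable ?H borel"
  proof (rule measurable_sigma_sets[OF sets_borel_padic])
    fix A :: "'p padic set" assume "A \<in> padic_balls"
    thus "?g -` A \<inter> space ?H \<in> sets ?H"
      using vim by (auto simp: padic_balls_def space_restrict_space sets_restrict_space_iff)
  qed auto
  have "is_padic_haar (distr ?H borel ?g)"
  proof (rule is_padic_haarI)
    fix a :: "'p padic" and k
    have "emeasure (distr ?H borel ?g) (cball a (real CARD('p) powi k))
        = emeasure ?H (?g -` cball a (real CARD('p) powi k) \<inter> {0..})"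
      by (subst emeasure_distr[OF me]) (auto simp: space_restrict_space)
    also have "\<dots> = emeasure lborel (?g -` cball a (real CARD('p) powi k) \<inter> {0..})"
      by (rule emeasure_restrict_space) auto
    also have "\<dots> = ennreal (real CARD('p) powi k)" using vim by blast
    finally show "emeasure (distr ?H borel ?g) (cball a (real CARD('p) powi k))
        = ennreal (real CARD('p) powi k)" .
  qed auto
  thus "\<exists>M :: 'p padic measure. is_padic_haar M" by blast
  show "M = N" if "is_padic_haar M" "is_padic_haar N" for M N :: "'p padic measure"
    using that by (intro padic_measure_eqI) (auto simp: is_padic_haar_def)
qed

definition padic_haar :: "'p::prime_card padic measure" where
  "padic_haar = (THE M. is_padic_haar M)"

lemma is_padic_haar_padic_haar: "is_padic_haar padic_haar"
  unfolding padic_haar_def by (rule theI'[OF ex1_padic_haar])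

text \<open>Coprimality is in the polynomial ring over the p-adic numbers.  Since Q has no root, P/Q is
  defined everywhere.\<close>

definition padic_rational_function :: "('p::prime_card padic \<Rightarrow> 'p padic) \<Rightarrow> bool" where
  "padic_rational_function f \<longleftrightarrow>
     (\<exists>P Q. coprime P Q \<and> (\<forall>x. poly Q x \<noteq> 0) \<and> (\<forall>x. f x = poly P x / poly Q x))"

definition locally_1_lipschitz :: "('a::metric_space \<Rightarrow> 'b::metric_space) \<Rightarrow> bool" where
  "locally_1_lipschitz f \<longleftrightarrow>
     (\<forall>a. \<exists>r>0. \<forall>x\<in>cball a r. \<forall>y\<in>cball a r. dist (f x) (f y) \<le> dist x y)"

definition locally_isometric :: "('a::metric_space \<Rightarrow> 'b::metric_space) \<Rightarrow> bool" where
  "locally_isometric f \<longleftrightarrow>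
     (\<forall>a. \<exists>r>0. \<forall>x\<in>cball a r. \<forall>y\<in>cball a r. dist (f x) (f y) = dist x y)"

definition measure_preserving :: "'a measure \<Rightarrow> ('a \<Rightarrow> 'a) \<Rightarrow> bool" where
  "measure_preserving M f \<longleftrightarrow> f \<in> measurable M M \<and>
     (\<forall>A\<in>sets M. emeasure M (f -` A \<inter> space M) = emeasure M A)"

end

theory Submission
  imports Defs
begin

text \<open>Let f be measure-preserving.  Two points with the same image have disjoint neighbourhoods of
  measure s inside the preimage of one ball of measure s, so f is injective.  The difference quotient
  of f is continuous in both variables, so near each point it either has constant absolute value,
  which makes f isometric there, or f contracts small balls, which contradicts the invariance of the
  measure.  If f were bounded near infinity, the preimage of some ball would have infinite measure;
  hence the numerator has the larger degree, f is proper, and its dense image is closed.  Conversely,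
  an isometry maps a compact ball onto a ball of the same radius, and the preimage of a ball is a
  countable disjoint union of balls on which f is isometric.\<close>

section \<open>Continuity of p-adic rational functions\<close>

lemma padic_abs_triangle: "padic_abs (x + y :: 'p::prime_card padic) \<le> padic_abs x + padic_abs y"
  using padic_abs_ultra[of x y] padic_abs_nonneg[of x] padic_abs_nonneg[of y] by linarith

text \<open>These instances make the general continuity rules for sums, differences and products
  available. Each limit is reduced to a real estimate of the distance that vanishes at (a,
  b).\<close>

instance padic :: (prime_card) topological_group_add
proof
  fix a b :: "'a padic"
  have "((\<lambda>z. dist (fst z) a + dist (snd z) b) \<longlongrightarrow> dist a a + dist b b) (nhds (a, b))"
    unfolding nhds_prod
    by (intro tendsto_add tendsto_dist tendsto_const filterlim_fst filterlim_snd)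
  then have *: "((\<lambda>z. dist (fst z) a + dist (snd z) b) \<longlongrightarrow> 0) (nhds (a, b))"
    by simp
  have "dist (x + y) (a + b) \<le> dist x a + dist y b" for x y
    using padic_abs_triangle[of "x - a" "y - b"] by (simp add: dist_padic_def algebra_simps)
  then show "((\<lambda>z. fst z + snd z) \<longlongrightarrow> a + b) (nhds a \<times>\<^sub>F nhds b)"
    unfolding nhds_prod[symmetric] tendsto_dist_iff[of "\<lambda>z. fst z + snd z"]
    by (intro Lim_null_comparison[OF always_eventually *]) auto
  have "((\<lambda>x. dist x a) \<longlongrightarrow> dist a a) (nhds a)"
    by (intro tendsto_dist tendsto_const filterlim_ident)
  moreover have "dist (- x) (- a) = dist x a" for x
    using padic_abs_diff_commute[of x a] by (simp add: dist_padic_def)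
  ultimately show "(uminus \<longlongrightarrow> - a) (nhds a)"
    unfolding tendsto_dist_iff[of uminus] by simp
qed

instance padic :: (prime_card) topological_semigroup_mult
proof
  fix a b :: "'a padic"
  have "((\<lambda>z. dist (fst z) a * dist (snd z) 0 + dist a 0 * dist (snd z) b)
      \<longlongrightarrow> dist a a * dist b 0 + dist a 0 * dist b b) (nhds (a, b))"
    unfolding nhds_prod
    by (intro tendsto_add tendsto_mult tendsto_dist tendsto_const filterlim_fst filterlim_snd)
  then have *: "((\<lambda>z. dist (fst z) a * dist (snd z) 0 + dist a 0 * dist (snd z) b)
      \<longlongrightarrow> 0) (nhds (a, b))"
    by simp
  have "dist (x * y) (a * b) \<le> dist x a * dist y 0 + dist a 0 * dist y b" for x y
    using padic_abs_triangle[of "(x - a) * y" "a * (y - b)"]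
    by (simp add: dist_padic_def padic_abs_mult[symmetric] algebra_simps)
  then show "((\<lambda>z. fst z * snd z) \<longlongrightarrow> a * b) (nhds a \<times>\<^sub>F nhds b)"
    unfolding nhds_prod[symmetric] tendsto_dist_iff[of "\<lambda>z. fst z * snd z"]
    by (intro Lim_null_comparison[OF always_eventually *]) auto
qed

text \<open>Every ultrametric triangle is isosceles: |y| is at most the larger of |x - y| and |x|,
  and |x - y| is too small to be that maximum. Thus a perturbation smaller than y does not change
  the absolute value.\<close>

lemma padic_abs_eqI_dominant:
  fixes x y :: "'p::prime_card padic"
  assumes "padic_abs (x - y) < padic_abs y"
  shows "padic_abs x = padic_abs y"
  using assms padic_abs_ultra[of "x - y" y] padic_abs_ultra[of "y - x" x]
    padic_abs_diff_commute[of x y] by auto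

text \<open>Close to x the absolute value of f is constant, so 1/f(y) - 1/f(x) has size |f(y) -
  f(x)| divided by the fixed number |f(x)|^2.\<close>

lemma continuous_on_padic_inverse:
  fixes f :: "'b::topological_space \<Rightarrow> 'p::prime_card padic"
  assumes f: "continuous_on A f" and nz: "\<And>x. x \<in> A \<Longrightarrow> f x \<noteq> 0"
  shows "continuous_on A (\<lambda>x. inverse (f x))"
  unfolding continuous_on_def
proof
  fix x assume x: "x \<in> A"
  have pos: "padic_abs (f x) > 0"
    using nz[OF x] by (simp add: less_le)
  have lim: "(f \<longlongrightarrow> f x) (at x within A)"
    using f x by (auto simp: continuous_on_def)
  have ev: "\<forall>\<^sub>F y in at x within A. padic_abs (f y) = padic_abs (f x)"
    using tendstoD[OF lim pos]
    by eventually_elim (auto simp: dist_padic_def intro: padic_abs_eqI_dominant)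
  have "\<forall>\<^sub>F y in at x within A.
      norm (dist (inverse (f y)) (inverse (f x))) \<le> dist (f y) (f x) / (padic_abs (f x))\<^sup>2"
    using ev
  proof eventually_elim
    case (elim y)
    then have "f y \<noteq> 0" using pos by auto
    then have "inverse (f y) - inverse (f x) = (f x - f y) * inverse (f y * f x)"
      using nz[OF x] by (simp add: field_simps)
    then have "dist (inverse (f y)) (inverse (f x)) = dist (f y) (f x) / (padic_abs (f x))\<^sup>2"
      by (simp only: dist_padic_def padic_abs_mult padic_abs_inverse elim
          padic_abs_diff_commute[of "f x" "f y"] power2_eq_square divide_inverse)
    then show ?case by simp
  qed
  moreover have "((\<lambda>y. dist (f y) (f x) / (padic_abs (f x))\<^sup>2) \<longlongrightarrow> 0) (at x within A)"
    using tendsto_divide[OF tendsto_dist[OF lim tendsto_const] tendsto_const,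
        of "(padic_abs (f x))\<^sup>2" "f x"] nz[OF x] by simp
  ultimately show "((\<lambda>y. inverse (f y)) \<longlongrightarrow> inverse (f x)) (at x within A)"
    unfolding tendsto_dist_iff[of "\<lambda>y. inverse (f y)"] by (rule Lim_null_comparison)
qed

lemma continuous_on_padic_poly:
  fixes f :: "'b::topological_space \<Rightarrow> 'p::prime_card padic"
  assumes "continuous_on A f"
  shows "continuous_on A (\<lambda>x. poly P (f x))"
  using assms by (induction P) (auto intro!: continuous_intros)

text \<open>Dividing out x - y algebraically gives a quotient that is polynomial in both variables,
  hence continuous across the diagonal, where it is the derivative.\<close>

lemma poly_difference_quotient:
  fixes P :: "'p::prime_card padic poly"
  obtains h where "continuous_on UNIV h"
    "\<And>x y. poly P x - poly P y = (x - y) * h (x, y)"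
proof -
  have "\<exists>h. continuous_on UNIV h \<and> (\<forall>x y. poly P x - poly P y = (x - y) * h (x, y))"
  proof (induction P)
    case 0
    show ?case by (intro exI[of _ "\<lambda>_. 0"]) auto
  next
    case (pCons a P)
    then obtain h where h: "continuous_on UNIV h"
      "\<And>x y. poly P x - poly P y = (x - y) * h (x, y)" by blast
    let ?g = "\<lambda>z. poly P (fst z) + snd z * h z"
    have "poly (pCons a P) x - poly (pCons a P) y = (x - y) * ?g (x, y)" for x y
    proof -
      have "poly (pCons a P) x - poly (pCons a P) y
          = (x - y) * poly P x + y * (poly P x - poly P y)"
        by (simp add: algebra_simps)
      also have "\<dots> = (x - y) * ?g (x, y)"
        unfolding h(2) by (simp add: algebra_simps)
      finally show ?thesis .
    qed
    moreover have "continuous_on UNIV ?g"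
      using h(1) by (intro continuous_intros continuous_on_padic_poly)
    ultimately show ?case by blast
  qed
  then show ?thesis using that by blast
qed

lemma continuous_on_padic_rational:
  fixes P Q :: "'p::prime_card padic poly"
  assumes "\<And>x. poly Q x \<noteq> 0"
  shows "continuous_on A (\<lambda>x. poly P x / poly Q x)"
  unfolding divide_inverse using assms
  by (intro continuous_intros continuous_on_padic_inverse continuous_on_padic_poly)

lemma rational_difference_quotient:
  fixes P Q :: "'p::prime_card padic poly"
  assumes Q: "\<And>x. poly Q x \<noteq> 0" and f: "\<And>x. f x = poly P x / poly Q x"
  obtains h where "continuous_on UNIV h"
    "\<And>x y. f x - f y = (x - y) * h (x, y)"
proof -
  obtain hP where hP: "continuous_on UNIV hP"
    "\<And>x y. poly P x - poly P y = (x - y) * hP (x, y)"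
    using poly_difference_quotient[of P] by metis
  obtain hQ where hQ: "continuous_on UNIV hQ"
    "\<And>x y. poly Q x - poly Q y = (x - y) * hQ (x, y)"
    using poly_difference_quotient[of Q] by metis
  \<comment> \<open>Read off from f x - f y = ((P x - P y) - f y (Q x - Q y)) / Q x. The factor f y
    is spelled out as a fraction so that the continuity rules apply.\<close>
  define h where "h z = (hP z - poly P (snd z) / poly Q (snd z) * hQ z) * inverse (poly Q (fst z))"
    for z
  have "continuous_on UNIV h"
    unfolding h_def divide_inverse using hP(1) hQ(1) Q
    by (intro continuous_intros continuous_on_padic_inverse continuous_on_padic_poly)
  moreover have "f x - f y = (x - y) * h (x, y)" for x y
  proof -
    have h: "h (x, y) = (hP (x, y) - f y * hQ (x, y)) * inverse (poly Q x)"
      by (simp add: h_def f)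
    have "f x - f y = ((poly P x - poly P y) - f y * (poly Q x - poly Q y)) * inverse (poly Q x)"
      using Q[of x] Q[of y] by (simp add: f field_simps)
    also have "\<dots> = (x - y) * h (x, y)"
      unfolding hP(2) hQ(2) h by (simp add: algebra_simps)
    finally show ?thesis .
  qed
  ultimately show ?thesis using that by blast
qed

section \<open>Absolute values of polynomials near infinity\<close>

lemma padic_abs_poly_at_infinity:
  fixes P :: "'p::prime_card padic poly"
  assumes "P \<noteq> 0"
  obtains R where "\<And>x. padic_abs x > R \<Longrightarrow>
    padic_abs (poly P x) = padic_abs (lead_coeff P) * padic_abs x ^ degree P"
proof -
  have "\<exists>R. \<forall>x. padic_abs x > R \<longrightarrow>
      padic_abs (poly P x) = padic_abs (lead_coeff P) * padic_abs x ^ degree P"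
    using assms
  proof (induction P)
    case (pCons a P)
    show ?case
    proof (cases "P = 0")
      case False
      then obtain R where R: "\<And>x. padic_abs x > R \<Longrightarrow>
          padic_abs (poly P x) = padic_abs (lead_coeff P) * padic_abs x ^ degree P"
        using pCons.IH by blast
      let ?c = "padic_abs (lead_coeff P)"
      have c: "?c > 0" using False by (simp add: less_le)
      \<comment> \<open>Beyond this radius x P(x) dominates the constant coefficient a. The bound 1
        ensures that |x| is at most its power with exponent deg P + 1, the bound |a|/c that |a| < c
        |x|.\<close>
      have "padic_abs (poly (pCons a P) x)
          = padic_abs (lead_coeff (pCons a P)) * padic_abs x ^ degree (pCons a P)"
        if x: "padic_abs x > max R (max 1 (padic_abs a / ?c))" for x
      proof -
        have "padic_abs a < ?c * padic_abs x"
          using x c by (simp add: field_simps)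
        also have "\<dots> \<le> ?c * padic_abs x ^ Suc (degree P)"
          using x c by (intro mult_left_mono self_le_power) auto
        also have eq: "\<dots> = padic_abs (x * poly P x)"
          using R[of x] x by (simp add: padic_abs_mult)
        finally have "padic_abs (a + x * poly P x) = padic_abs (x * poly P x)"
          by (intro padic_abs_eqI_dominant) simp
        then show ?thesis using eq False by simp
      qed
      then show ?thesis by blast
    qed auto
  qed auto
  then show ?thesis using that by blast
qed

lemma padic_abs_cofinal:
  obtains x :: "'p::prime_card padic" and n :: nat
  where "padic_abs x = real CARD('p) ^ n" "padic_abs x > R" "n > m"
proof -
  obtain n where n: "R < real CARD('p) ^ n"
    using real_arch_pow[OF padic_CARD_gt_1[where 'p='p]] by blast
  also have "\<dots> \<le> real CARD('p) ^ (Suc (n + m))"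
    using padic_CARD_gt_1[where 'p='p] by (intro power_increasing) auto
  finally show ?thesis
    \<comment> \<open>Negative powers of p are the large elements; the exponent exceeds both n and
      m.\<close>
    using that[of "of_nat CARD('p) powi (- int (Suc (n + m)))" "Suc (n + m)"]
    by (simp only: padic_abs_p_powi minus_minus power_int_of_nat)
qed

section \<open>Compactness of balls\<close>

text \<open>Scaling by an element w with |w| = p^k reduces to the unit ball, where every element is
  congruent to one of the p digits modulo elements of absolute value below 1.\<close>

lemma padic_cball_subdivision:
  fixes a :: "'p::prime_card padic"
  obtains F where "finite F" "cball a (real CARD('p) powi k) \<subseteq> (\<Union>b\<in>F. cball b (real CARD('p) powi (k - 1)))"
proof -
  let ?p = "real CARD('p)"
  define w :: "'p padic" where "w = of_nat CARD('p) powi (- k)"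
  have w: "padic_abs w = ?p powi k" unfolding w_def by (simp add: padic_abs_p_powi)
  have wpos: "?p powi k > 0" using padic_CARD_gt_1[where 'p='p] by simp
  then have w0: "w \<noteq> 0" using w by auto
  let ?D = "(\<lambda>d. a + of_nat d * w) ` {..<CARD('p)}"
  have "x \<in> (\<Union>b\<in>?D. cball b (?p powi (k - 1)))" if x: "x \<in> cball a (?p powi k)" for x
  proof -
    have "padic_abs (x - a) \<le> ?p powi k"
      using x by (simp add: dist_padic_def padic_abs_diff_commute[of a])
    then have "padic_abs ((x - a) / w) \<le> 1"
      using wpos by (simp only: padic_abs_divide w) simp
    then obtain d where d: "d < CARD('p)" "padic_abs ((x - a) / w - of_nat d) < 1"
      using padic_residue by blast
    have "x - (a + of_nat d * w) = ((x - a) / w - of_nat d) * w"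
      using w0 by (simp add: field_simps)
    \<comment> \<open>Absolute values are 0 or powers of p, so below p^k means at most p^(k-1); the
      exponent is written to match \<open>padic_abs_lt_imp_le\<close>.\<close>
    then have "padic_abs (x - (a + of_nat d * w)) < ?p powi (k - 1 + 1)"
      using d(2) wpos by (simp only: padic_abs_mult w) simp
    from padic_abs_lt_imp_le[OF this]
    have "x \<in> cball (a + of_nat d * w) (?p powi (k - 1))"
      by (simp add: dist_padic_def padic_abs_diff_commute[of _ x])
    then show ?thesis using d(1) by blast
  qed
  then show ?thesis using that[of ?D] by blast
qed

lemma finite_cover_padic_cball:
  fixes a :: "'p::prime_card padic"
  shows "\<exists>F. finite F \<and> cball a (real CARD('p) powi k) \<subseteq> (\<Union>b\<in>F. cball b (real CARD('p) powi (k - int n)))"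
proof (induction n)
  case 0
  show ?case by (intro exI[of _ "{a}"]) simp
next
  case (Suc n)
  let ?p = "real CARD('p)"
  obtain F where F: "finite F" "cball a (?p powi k) \<subseteq> (\<Union>b\<in>F. cball b (?p powi (k - int n)))"
    using Suc.IH by blast
  have "\<exists>G. finite G \<and> cball b (?p powi (k - int n)) \<subseteq> (\<Union>c\<in>G. cball c (?p powi (k - int (Suc n))))"
    for b :: "'p padic"
    using padic_cball_subdivision[of b "k - int n"] by (simp add: algebra_simps) metis
  then obtain G where G: "\<And>b :: 'p padic. finite (G b)"
    "\<And>b :: 'p padic. cball b (?p powi (k - int n)) \<subseteq> (\<Union>c\<in>G b. cball c (?p powi (k - int (Suc n))))"
    by metis
  have "finite (\<Union>b\<in>F. G b)"
    using F(1) G(1) by blast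
  moreover have "(\<Union>b\<in>F. cball b (?p powi (k - int n)))
      \<subseteq> (\<Union>c\<in>(\<Union>b\<in>F. G b). cball c (?p powi (k - int (Suc n))))"
    unfolding UN_UN_flatten using G(2) by (rule UN_mono[OF subset_refl])
  then have "cball a (?p powi k) \<subseteq> (\<Union>c\<in>(\<Union>b\<in>F. G b). cball c (?p powi (k - int (Suc n))))"
    using F(2) by (rule order_trans[rotated])
  ultimately show ?case by blast
qed

text \<open>The ball is complete, and repeated subdivision makes it totally bounded.\<close>

lemma compact_padic_cball: "compact (cball (a :: 'p::prime_card padic) r)"
proof -
  let ?p = "real CARD('p)"
  obtain m where m: "r < ?p ^ m"
    using real_arch_pow[OF padic_CARD_gt_1[where 'p='p]] by blast
  have "\<exists>F. finite F \<and> cball a r \<subseteq> (\<Union>b\<in>F. ball b e)" if e: "e > 0" for e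
  proof -
    obtain n where n: "?p powi (- int n) < e"
      using padic_powi_lt[OF e, where 'p='p] by blast
    \<comment> \<open>Each subdivision divides the radius by p: m of them bring the enclosing radius
      p^m down to 1, and n more bring it below e.\<close>
    obtain F where F: "finite F"
      "cball a (?p powi int m) \<subseteq> (\<Union>b\<in>F. cball b (?p powi (int m - int (n + m))))"
      using finite_cover_padic_cball[of a "int m" "n + m"] by metis
    have "cball a r \<subseteq> cball a (?p powi int m)"
      using m by (intro subset_cball) simp
    also note F(2)
    also have "int m - int (n + m) = - int n" by simp
    also have "(\<Union>b\<in>F. cball b (?p powi (- int n))) \<subseteq> (\<Union>b\<in>F. ball b e)"
      using n by (intro UN_mono) (auto simp del: power_int_minus)
    finally show ?thesis using F(1) by blast
  qed
  moreover have "complete (cball a r)"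
    by (simp add: complete_eq_closed)
  ultimately show ?thesis by (simp add: compact_eq_totally_bounded)
qed

text \<open>A point y of K outside the closed image of T keeps a distance e from it. T carries this
  gap along the orbit of y, so the orbit points are pairwise at least e apart and no subsequence can
  converge.\<close>

lemma compact_isometry_onto:
  fixes T :: "'a::metric_space \<Rightarrow> 'a"
  assumes K: "compact K" and sub: "T ` K \<subseteq> K"
    and iso: "\<And>x y. x \<in> K \<Longrightarrow> y \<in> K \<Longrightarrow> dist (T x) (T y) = dist x y"
  shows "T ` K = K"
proof (rule ccontr)
  assume "T ` K \<noteq> K"
  then obtain y where y: "y \<in> K" "y \<notin> T ` K" using sub by blast
  have "continuous_on K T"
    unfolding continuous_on_iff by (metis iso)
  then have "open (- T ` K)"
    using K by (intro open_Compl compact_imp_closed compact_continuous_image)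
  then obtain e where e: "e > 0" "ball y e \<subseteq> - T ` K"
    using y(2) by (meson ComplI openE)
  have far: "e \<le> dist y (T x)" if "x \<in> K" for x
    using e(2) that by force
  define u where "u n = (T ^^ n) y" for n
  have uK: "u n \<in> K" for n
    by (induction n) (use y sub in \<open>auto simp: u_def\<close>)
  have shift: "dist (u m) (u (m + k)) = dist y (u k)" for m k
  proof (induction m)
    case (Suc m)
    then show ?case using iso[OF uK uK, of m "m + k"] by (simp add: u_def)
  qed (simp add: u_def)
  have sep: "e \<le> dist (u m) (u n)" if less: "m < n" for m n
  proof -
    obtain k where "n = m + Suc k" using less_imp_Suc_add[OF less] by auto
    moreover have "u (Suc k) = T (u k)" by (simp add: u_def)
    ultimately show ?thesis using shift[of m "Suc k"] far[OF uK, of k] by simp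
  qed
  obtain l r where r: "strict_mono (r :: nat \<Rightarrow> nat)" "(u \<circ> r) \<longlonglongrightarrow> l"
    using K uK compact_def[of K] by meson
  from LIMSEQ_imp_Cauchy[OF r(2)] e(1) obtain N where
    "\<And>m n. m \<ge> N \<Longrightarrow> n \<ge> N \<Longrightarrow> dist ((u \<circ> r) m) ((u \<circ> r) n) < e"
    by (meson metric_CauchyD)
  from this[of N "Suc N"] sep[of "r N" "r (Suc N)"] strict_monoD[OF r(1), of N "Suc N"]
  show False by simp
qed

text \<open>Translating by a - f a turns f into an isometric self-map of a compact ball, which is
  onto.\<close>

lemma padic_isometry_image_cball:
  fixes f :: "'p::prime_card padic \<Rightarrow> 'p padic"
  assumes "r \<ge> 0" and iso: "\<And>x y. x \<in> cball a r \<Longrightarrow> y \<in> cball a r \<Longrightarrow> dist (f x) (f y) = dist x y"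
  shows "f ` cball a r = cball (f a) r"
proof -
  let ?T = "\<lambda>x. f x - f a + a"
  have d: "dist (?T x) (?T y) = dist (f x) (f y)" for x y
    by (simp add: dist_padic_def)
  have "?T ` cball a r \<subseteq> cball a r"
    using iso[of a] assms(1) d[of a] by auto
  then have T: "?T ` cball a r = cball a r"
    by (intro compact_isometry_onto compact_padic_cball) (auto simp: iso d)
  show ?thesis
  proof (intro equalityI subsetI)
    fix y assume "y \<in> f ` cball a r"
    then show "y \<in> cball (f a) r" using iso[of a] assms(1) by auto
  next
    fix y assume "y \<in> cball (f a) r"
    then have "y - f a + a \<in> cball a r" by (simp add: dist_padic_def algebra_simps)
    then have "y - f a + a \<in> ?T ` cball a r" using T by simp
    then show "y \<in> f ` cball a r" by auto
  qed
qed

section \<open>Measure-preserving maps\<close>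

lemma open_padic_cball: "r > 0 \<Longrightarrow> open (cball (a :: 'p::prime_card padic) r)"
  unfolding open_contains_ball
  by (intro ballI exI[of _ r]) (auto intro: padic_ultra_mem[OF _ less_imp_le])

lemma padic_powi_pos: "real CARD('p::prime_card) powi k > 0"
  using padic_CARD_gt_1[where 'p='p] by simp

lemma padic_powi_le_iff: "real CARD('p::prime_card) powi k \<le> real CARD('p) powi l \<longleftrightarrow> k \<le> l"
proof
  assume "k \<le> l"
  then show "real CARD('p) powi k \<le> real CARD('p) powi l"
    using padic_CARD_gt_1[where 'p='p] by (intro power_int_increasing) auto
next
  assume "real CARD('p) powi k \<le> real CARD('p) powi l"
  then show "k \<le> l"
    using power_int_strict_increasing[of l k "real CARD('p)"] padic_CARD_gt_1[where 'p='p]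
    by (meson not_less)
qed

lemma sets_padic_haar: "sets (padic_haar :: 'p::prime_card padic measure) = sets borel"
  using is_padic_haar_padic_haar[where 'a='p] by (simp add: is_padic_haar_def)

lemma space_padic_haar: "space (padic_haar :: 'p::prime_card padic measure) = UNIV"
  using sets_eq_imp_space_eq[OF sets_padic_haar] by simp

lemma emeasure_padic_haar_cball:
  "emeasure padic_haar (cball (a :: 'p::prime_card padic) (real CARD('p) powi k))
    = ennreal (real CARD('p) powi k)"
  using is_padic_haar_padic_haar[where 'a='p] by (simp add: is_padic_haar_def)

lemma measure_preserving_vimage_cball:
  fixes f :: "'p::prime_card padic \<Rightarrow> 'p padic"
  assumes f: "measure_preserving padic_haar f"
  shows "f -` cball b (real CARD('p) powi k) \<in> sets padic_haar"
    and "emeasure padic_haar (f -` cball b (real CARD('p) powi k)) = ennreal (real CARD('p) powi k)"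
proof -
  have B: "cball b (real CARD('p) powi k) \<in> sets padic_haar"
    unfolding sets_padic_haar by (rule borel_closed[OF closed_cball])
  have m: "f \<in> measurable padic_haar padic_haar"
    and e: "\<And>A. A \<in> sets padic_haar \<Longrightarrow>
      emeasure padic_haar (f -` A \<inter> space padic_haar) = emeasure padic_haar A"
    using f unfolding measure_preserving_def by (rule conjunct1, blast)
  show "f -` cball b (real CARD('p) powi k) \<in> sets padic_haar"
    using measurable_sets[OF m B] unfolding space_padic_haar Int_UNIV_right .
  show "emeasure padic_haar (f -` cball b (real CARD('p) powi k)) = ennreal (real CARD('p) powi k)"
    using e[OF B] unfolding space_padic_haar Int_UNIV_right emeasure_padic_haar_cball .
qed

lemma measure_preserving_emeasure_le:
  fixes f :: "'p::prime_card padic \<Rightarrow> 'p padic"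
  assumes f: "measure_preserving padic_haar f" and sub: "f ` S \<subseteq> cball b (real CARD('p) powi k)"
  shows "emeasure padic_haar S \<le> ennreal (real CARD('p) powi k)"
  using emeasure_mono[OF _ measure_preserving_vimage_cball(1)[OF f], of S b k] sub
  unfolding measure_preserving_vimage_cball(2)[OF f] image_subset_iff_subset_vimage by blast

text \<open>The source of the contradictions below: f cannot squeeze a ball into a smaller one,
  neither near a point nor near infinity.\<close>

lemma measure_preserving_cball_radius_le:
  fixes f :: "'p::prime_card padic \<Rightarrow> 'p padic"
  assumes "measure_preserving padic_haar f"
    and "f ` cball a (real CARD('p) powi k) \<subseteq> cball b (real CARD('p) powi l)"
  shows "k \<le> l"
proof -
  have "ennreal (real CARD('p) powi k) \<le> ennreal (real CARD('p) powi l)"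
    using measure_preserving_emeasure_le[OF assms] unfolding emeasure_padic_haar_cball .
  then show ?thesis
    unfolding ennreal_le_iff[OF less_imp_le[OF padic_powi_pos]] padic_powi_le_iff .
qed

section \<open>Injectivity and local isometry\<close>

lemma measure_preserving_imp_inj:
  fixes f :: "'p::prime_card padic \<Rightarrow> 'p padic"
  assumes f: "measure_preserving padic_haar f" and lip: "locally_1_lipschitz f"
  shows "inj f"
proof (rule injI, rule ccontr)
  fix x y assume xy: "f x = f y" "x \<noteq> y"
  obtain r1 where r1: "r1 > 0" "\<And>u v. u \<in> cball x r1 \<Longrightarrow> v \<in> cball x r1 \<Longrightarrow> dist (f u) (f v) \<le> dist u v"
    using lip unfolding locally_1_lipschitz_def by meson
  obtain r2 where r2: "r2 > 0" "\<And>u v. u \<in> cball y r2 \<Longrightarrow> v \<in> cball y r2 \<Longrightarrow> dist (f u) (f v) \<le> dist u v"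
    using lip unfolding locally_1_lipschitz_def by meson
  \<comment> \<open>The radius s stays below both Lipschitz radii and below the distance of x and y,
    which makes the two balls disjoint; it is a power of p so that their measures are known.\<close>
  have "min r1 (min r2 (dist x y)) > 0" using r1(1) r2(1) xy(2) by simp
  then obtain n :: nat where n: "real CARD('p) powi (- int n) < min r1 (min r2 (dist x y))"
    using padic_powi_lt[where 'p='p] by blast
  define s where "s = real CARD('p) powi (- int n)"
  have s: "s > 0" "s < r1" "s < r2" "s < dist x y"
    using n padic_powi_pos[where 'p='p, of "- int n"] by (simp_all add: s_def)
  have "dist (f x) (f u) \<le> s" if "u \<in> cball x s" for u
    using r1(2)[of x u] that r1(1) s by auto
  moreover have "dist (f x) (f u) \<le> s" if "u \<in> cball y s" for u
    using r2(2)[of y u] that r2(1) s xy(1) by auto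
  ultimately have "f ` (cball x s \<union> cball y s) \<subseteq> cball (f x) s" by auto
  then have "emeasure padic_haar (cball x s \<union> cball y s) \<le> ennreal s"
    unfolding s_def by (rule measure_preserving_emeasure_le[OF f])
  moreover have "cball x s \<inter> cball y s = {}"
    using s(4) padic_ultra_mem[of x _ s y] by (auto simp: dist_commute)
  then have "emeasure padic_haar (cball x s \<union> cball y s)
      = emeasure padic_haar (cball x s) + emeasure padic_haar (cball y s)"
    by (intro plus_emeasure[symmetric]) (auto simp: sets_padic_haar borel_closed)
  \<comment> \<open>A set of measure 2s has been mapped into a ball of measure s.\<close>
  ultimately have "ennreal (s + s) \<le> ennreal s"
    using s(1) unfolding s_def emeasure_padic_haar_cball by (simp add: ennreal_plus[symmetric] del: ennreal_plus)
  then show False using s(1) by (simp add: ennreal_le_iff)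
qed

text \<open>Near (a, a) the quotient h varies by less than 1. If |h(a, a)| \<ge> 1, then |h| is
  constant there, f does not contract, and the Lipschitz bound gives equality. If |h(a, a)| < 1,
  then f shrinks a ball about a by at least a factor p.\<close>

lemma measure_preserving_imp_locally_isometric:
  fixes f :: "'p::prime_card padic \<Rightarrow> 'p padic"
  assumes f: "measure_preserving padic_haar f" and lip: "locally_1_lipschitz f"
    and h: "continuous_on UNIV h" "\<And>x y. f x - f y = (x - y) * h (x, y)"
  shows "locally_isometric f"
  unfolding locally_isometric_def
proof
  fix a
  have dist_f: "dist (f x) (f y) = dist x y * padic_abs (h (x, y))" for x y
    unfolding dist_padic_def h(2) by (rule padic_abs_mult)
  obtain d where d: "d > 0" "\<And>z. dist z (a, a) < d \<Longrightarrow> dist (h z) (h (a, a)) < 1"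
    using h(1) unfolding continuous_on_iff by (meson UNIV_I zero_less_one)
  \<comment> \<open>The distance in the product is at most the sum of the two distances, here 2d/3 <
    d.\<close>
  have near: "padic_abs (h (x, y) - h (a, a)) < 1" if "x \<in> cball a (d / 3)" "y \<in> cball a (d / 3)" for x y
  proof -
    have "dist (x, y) (a, a) \<le> dist x a + dist y a"
      by (simp add: dist_Pair_Pair sqrt_sum_squares_le_sum)
    also have "\<dots> < d" using that d(1) by (simp add: dist_commute)
    finally show ?thesis using d(2) by (simp add: dist_padic_def)
  qed
  show "\<exists>r>0. \<forall>x\<in>cball a r. \<forall>y\<in>cball a r. dist (f x) (f y) = dist x y"
  proof (cases "padic_abs (h (a, a)) \<ge> 1")
    case True
    obtain r where r: "r > 0" "\<And>x y. x \<in> cball a r \<Longrightarrow> y \<in> cball a r \<Longrightarrow> dist (f x) (f y) \<le> dist x y"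
      using lip unfolding locally_1_lipschitz_def by meson
    have "dist (f x) (f y) = dist x y"
      if "x \<in> cball a (min r (d / 3))" "y \<in> cball a (min r (d / 3))" for x y
    proof -
      have "padic_abs (h (x, y)) = padic_abs (h (a, a))"
        using near[of x y] that True by (intro padic_abs_eqI_dominant) auto
      then have "dist x y \<le> dist (f x) (f y)"
        using True by (simp add: dist_f mult_le_cancel_left1)
      then show ?thesis using r(2)[of x y] that by (intro antisym) auto
    qed
    then show ?thesis using r(1) d(1) by (intro exI[of _ "min r (d / 3)"]) auto
  next
    case False
    obtain n :: nat where n: "real CARD('p) powi (- int n) < d / 3"
      using padic_powi_lt[where 'p='p, of "d / 3"] d(1) by auto
    let ?k = "- int n"
    have "f ` cball a (real CARD('p) powi ?k) \<subseteq> cball (f a) (real CARD('p) powi (?k - 1))"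
    proof (rule image_subsetI)
      fix x assume x: "x \<in> cball a (real CARD('p) powi ?k)"
      have "padic_abs (h (a, x) - h (a, a)) < 1"
        using x n d(1) by (intro near) auto
      then have "padic_abs (h (a, x)) < 1"
        using False padic_abs_ultra[of "h (a, x) - h (a, a)" "h (a, a)"] by auto
      then have "dist (f a) (f x) < real CARD('p) powi ?k"
        using x padic_powi_pos[where 'p='p, of ?k]
        by (cases "a = x") (auto simp: dist_f intro: less_le_trans[rotated])
      \<comment> \<open>Discreteness of the absolute value turns the strict inequality into a gain
        of a full factor p.\<close>
      then have "padic_abs (f a - f x) < real CARD('p) powi (?k - 1 + 1)"
        by (simp add: dist_padic_def)
      from padic_abs_lt_imp_le[OF this] show "f x \<in> cball (f a) (real CARD('p) powi (?k - 1))"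
        by (simp add: dist_padic_def)
    qed
    from measure_preserving_cball_radius_le[OF f this] show ?thesis by simp
  qed
qed

section \<open>Behaviour at infinity and surjectivity\<close>

lemma measure_preserving_unbounded_at_infinity:
  fixes f :: "'p::prime_card padic \<Rightarrow> 'p padic"
  assumes f: "measure_preserving padic_haar f"
  shows "\<exists>x. padic_abs x > R \<and> padic_abs (f x) > M"
proof (rule ccontr)
  assume "\<not> ?thesis"
  then have bdd: "\<And>x. padic_abs x > R \<Longrightarrow> padic_abs (f x) \<le> M" by force
  obtain k where k: "M < real CARD('p) ^ k"
    using real_arch_pow[OF padic_CARD_gt_1[where 'p='p]] by blast
  obtain x :: "'p padic" and n where x: "padic_abs x = real CARD('p) ^ n" "padic_abs x > R" "n > k + 1"
    using padic_abs_cofinal by blast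
  \<comment> \<open>The ball of radius p^(n-1) about x lies in the sphere |y| = p^n beyond R, so f
    would map it into a ball of radius p^k with k < n - 1.\<close>
  have "f ` cball x (real CARD('p) powi (int n - 1)) \<subseteq> cball 0 (real CARD('p) powi int k)"
  proof (rule image_subsetI)
    fix y assume y: "y \<in> cball x (real CARD('p) powi (int n - 1))"
    have "real CARD('p) powi (int n - 1) < real CARD('p) powi int n"
      using padic_CARD_gt_1[where 'p='p] by (intro power_int_strict_increasing) auto
    then have "padic_abs (y - x) < padic_abs x"
      using y by (simp add: x(1) dist_padic_def padic_abs_diff_commute[of x])
    then have "padic_abs y = padic_abs x" by (rule padic_abs_eqI_dominant)
    then show "f y \<in> cball 0 (real CARD('p) powi int k)"
      using bdd[of y] x(2) k by (simp add: dist_padic_def)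
  qed
  from measure_preserving_cball_radius_le[OF f this] x(3) show False by simp
qed

text \<open>Far out, |f x| is c |x|^(deg P) / |x|^(deg Q). For deg P \<le> deg Q it would be bounded
  by c there; hence deg P > deg Q and |f x| \<ge> c |x|.\<close>

lemma measure_preserving_rational_proper:
  fixes f :: "'p::prime_card padic \<Rightarrow> 'p padic"
  assumes f: "measure_preserving padic_haar f"
    and Q: "Q \<noteq> 0" and PQ: "\<And>x. f x = poly P x / poly Q x"
  obtains R where "\<And>x. padic_abs x > R \<Longrightarrow> padic_abs (f x) > M"
proof -
  have P: "P \<noteq> 0"
    using measure_preserving_unbounded_at_infinity[OF f, of 0 0] PQ by auto
  obtain RP where RP: "\<And>x. padic_abs x > RP \<Longrightarrow>
      padic_abs (poly P x) = padic_abs (lead_coeff P) * padic_abs x ^ degree P"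
    using padic_abs_poly_at_infinity[OF P] by blast
  obtain RQ where RQ: "\<And>x. padic_abs x > RQ \<Longrightarrow>
      padic_abs (poly Q x) = padic_abs (lead_coeff Q) * padic_abs x ^ degree Q"
    using padic_abs_poly_at_infinity[OF Q] by blast
  define c where "c = padic_abs (lead_coeff P) / padic_abs (lead_coeff Q)"
  have c: "c > 0" using P Q by (simp add: c_def less_le)
  \<comment> \<open>The bound 1 makes powers of |x| monotone in the exponent.\<close>
  define R where "R = max 1 (max RP RQ)"
  have fx: "padic_abs (f x) = c * (padic_abs x ^ degree P / padic_abs x ^ degree Q)"
    if "padic_abs x > R" for x
    using RP[of x] RQ[of x] that by (simp add: PQ padic_abs_divide c_def R_def)
  have deg: "degree P > degree Q"
  proof (rule ccontr)
    assume "\<not> degree P > degree Q"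
    then have "padic_abs (f x) \<le> c" if "padic_abs x > R" for x
      using that c power_increasing[of "degree P" "degree Q" "padic_abs x"]
      by (simp add: fx R_def divide_le_eq)
    then show False
      using measure_preserving_unbounded_at_infinity[OF f, of R c] by fastforce
  qed
  have "padic_abs (f x) > M" if x: "padic_abs x > max R (M / c)" for x
  proof -
    have x1: "padic_abs x > 1" using x by (simp add: R_def)
    have "M < c * padic_abs x" using x c by (simp add: field_simps)
    also have "\<dots> \<le> c * padic_abs x ^ (degree P - degree Q)"
      using c x1 deg by (intro mult_left_mono self_le_power) auto
    also have "\<dots> = padic_abs (f x)"
    proof -
      have "padic_abs x ^ degree P = padic_abs x ^ (degree P - degree Q) * padic_abs x ^ degree Q"
        using deg by (simp flip: power_add)
      then show ?thesis using x x1 by (subst fx) auto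
    qed
    finally show ?thesis .
  qed
  then show ?thesis using that by blast
qed

text \<open>Balls about b have positive measure, hence nonempty preimages, so b is a limit of values
  of f. Properness puts the arguments into one compact ball, whose image is closed.\<close>

lemma measure_preserving_proper_imp_surj:
  fixes f :: "'p::prime_card padic \<Rightarrow> 'p padic"
  assumes f: "measure_preserving padic_haar f" and cont: "continuous_on UNIV f"
    and proper: "\<And>M. \<exists>R. \<forall>x. padic_abs x > R \<longrightarrow> padic_abs (f x) > M"
  shows "surj f"
proof -
  have "b \<in> range f" for b
  proof -
    obtain R where R: "\<And>x. padic_abs x > R \<Longrightarrow> padic_abs (f x) > padic_abs b + 1"
      using proper by blast
    have "closed (f ` cball 0 R)"
      using cont by (intro compact_imp_closed compact_continuous_image compact_padic_cball)
        (auto intro: continuous_on_subset)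
    moreover have "\<exists>y\<in>f ` cball 0 R. dist y b < e" if e: "e > 0" for e
    proof -
      \<comment> \<open>The bound 1 forces |f x| \<le> |b| + 1, the threshold for which R was
        chosen.\<close>
      obtain n :: nat where n: "real CARD('p) powi (- int n) < min e 1"
        using padic_powi_lt[where 'p='p, of "min e 1"] e by auto
      let ?B = "cball b (real CARD('p) powi (- int n))"
      have "f -` ?B \<noteq> {}"
        using measure_preserving_vimage_cball(2)[OF f, of b "- int n"]
           padic_powi_pos[where 'p='p, of "- int n"] by (auto simp del: power_int_minus)
      then obtain x where "f x \<in> ?B" by blast
      then have x: "dist (f x) b < min e 1" using n by (simp add: dist_commute)
      then have "padic_abs (f x) \<le> padic_abs b + 1"
        using padic_abs_triangle[of "f x - b" b] by (simp add: dist_padic_def)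
      then have "x \<in> cball 0 R" using R[of x] by (force simp: dist_padic_def)
      then show ?thesis using x by auto
    qed
    ultimately have "b \<in> f ` cball 0 R" by (metis closed_approachable)
    then show ?thesis by blast
  qed
  then show ?thesis by blast
qed

section \<open>Locally isometric bijections\<close>

lemma locally_isometric_imp_continuous:
  assumes "locally_isometric f"
  shows "continuous_on UNIV f"
  unfolding continuous_on_iff
proof (intro ballI allI impI)
  fix a and e :: real assume e: "e > 0"
  obtain r where r: "r > 0" "\<And>x y. x \<in> cball a r \<Longrightarrow> y \<in> cball a r \<Longrightarrow> dist (f x) (f y) = dist x y"
    using assms unfolding locally_isometric_def by meson
  have "dist (f x) (f a) < e" if "dist x a < min r e" for x
    using r(2)[of x a] r(1) that by (simp add: dist_commute)
  then show "\<exists>d>0. \<forall>x\<in>UNIV. dist x a < d \<longrightarrow> dist (f x) (f a) < e"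
    using r(1) e by (intro exI[of _ "min r e"]) auto
qed

text \<open>The balls \<open>C x\<close> below are the maximal ones of radius at most 1 inside the preimage on which f is
  isometric.  By the ultrametric inequality maximality makes any two of them equal or disjoint.\<close>

lemma emeasure_vimage_cball:
  fixes f :: "'p::prime_card padic \<Rightarrow> 'p padic"
  assumes bij: "bij f" and iso: "locally_isometric f"
  shows "emeasure padic_haar (f -` cball b (real CARD('p) powi k))
    = emeasure padic_haar (cball b (real CARD('p) powi k))"
proof -
  let ?p = "real CARD('p)"
  define B where "B = cball b (?p powi k)"
  define U where "U = f -` B"
  have "open U"
    unfolding U_def B_def
    by (intro open_vimage open_padic_cball padic_powi_pos locally_isometric_imp_continuous iso)
  define good where "good x n \<longleftrightarrow> cball x (?p powi (- int n)) \<subseteq> U \<and>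
    (\<forall>u\<in>cball x (?p powi (- int n)). \<forall>v\<in>cball x (?p powi (- int n)). dist (f u) (f v) = dist u v)"
    for x n
  define N where "N x = (LEAST n. good x n)" for x
  define C where "C x = cball x (?p powi (- int (N x)))" for x
  have good_N: "good x (N x)" if x: "x \<in> U" for x
  proof -
    obtain e where e: "e > 0" "ball x e \<subseteq> U" using x \<open>open U\<close> openE by blast
    obtain r where r: "r > 0" "\<And>u v. u \<in> cball x r \<Longrightarrow> v \<in> cball x r \<Longrightarrow> dist (f u) (f v) = dist u v"
      using iso unfolding locally_isometric_def by meson
    obtain n :: nat where n: "?p powi (- int n) < min e r"
      using padic_powi_lt[where 'p='p, of "min e r"] e(1) r(1) by auto
    have "cball x (?p powi (- int n)) \<subseteq> ball x e" "cball x (?p powi (- int n)) \<subseteq> cball x r"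
      using n by auto
    then have "good x n" unfolding good_def using e(2) r(2) by blast
    then show ?thesis unfolding N_def by (rule LeastI)
  qed
  have C_mem: "x \<in> C x" for x
    using padic_powi_pos[where 'p='p, of "- int (N x)"] by (simp add: C_def)
  have C_eq: "C y = C x" if x: "x \<in> U" and y: "y \<in> C x" for x y
  proof -
    \<comment> \<open>Every point of a ball is a centre of it. So \<open>good\<close> passes from x
      to y at index \<open>N x\<close> and back at index \<open>N y\<close>, and minimality makes
      the two indices equal.\<close>
    have cb: "cball y (?p powi (- int (N x))) = cball x (?p powi (- int (N x)))"
      using y by (intro padic_cball_eq) (simp add: C_def dist_commute)
    have "good y (N x)" using good_N[OF x] unfolding good_def cb .
    then have le: "N y \<le> N x" unfolding N_def by (rule Least_le)
    have yU: "y \<in> U" using good_N[OF x] y by (auto simp: good_def C_def)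
    have "?p powi (- int (N x)) \<le> ?p powi (- int (N y))"
      using le by (simp only: padic_powi_le_iff)
    then have "x \<in> C y" using y by (simp add: C_def dist_commute)
    then have cb': "cball y (?p powi (- int (N y))) = cball x (?p powi (- int (N y)))"
      by (intro padic_cball_eq) (simp add: C_def)
    have "good x (N y)" using good_N[OF yU] unfolding good_def cb' .
    then have "N x \<le> N y" unfolding N_def by (rule Least_le)
    with le cb show ?thesis by (simp add: C_def)
  qed
  have C_sub: "C x \<subseteq> U" if "x \<in> U" for x
    using good_N[OF that] by (simp add: good_def C_def)
  have UC: "U = \<Union>(C ` U)" using C_mem C_sub by blast
  \<comment> \<open>Each ball contains a rational number, which then determines it; hence there are
    countably many.\<close>
  have "C ` U \<subseteq> C ` range of_rat"
  proof (rule image_subsetI)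
    fix x assume x: "x \<in> U"
    obtain q where "dist x (of_rat q) < ?p powi (- int (N x))"
      using padic_of_rat_dense[OF padic_powi_pos[where 'p='p]] by blast
    then have "C (of_rat q) = C x" using x by (intro C_eq) (auto simp: C_def)
    then show "C x \<in> C ` range of_rat" by (metis imageI rangeI)
  qed
  moreover have "countable (range (of_rat :: rat \<Rightarrow> 'p padic))" by simp
  ultimately have count: "countable (C ` U)" by (meson countable_image countable_subset)
  have disj: "disjoint_family_on (\<lambda>c. c) (C ` U)"
    unfolding disjoint_family_on_def using C_eq by blast
  then have disj_image: "disjoint_family_on (\<lambda>c. f ` c) (C ` U)"
    using bij_is_inj[OF bij] by (simp add: disjoint_family_on_def image_Int[symmetric])
  have image: "f ` C x = cball (f x) (?p powi (- int (N x)))" if "x \<in> U" for x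
    unfolding C_def using good_N[OF that] padic_powi_pos[where 'p='p, of "- int (N x)"]
    by (intro padic_isometry_image_cball) (auto simp: good_def simp del: power_int_minus)
  have "B = f ` U"
    unfolding U_def using bij by (simp add: bij_is_surj surj_image_vimage_eq)
  also have "\<dots> = \<Union>((\<lambda>c. f ` c) ` C ` U)"
    using UC by blast
  \<comment> \<open>Indexing by the balls themselves counts each ball once, although many x give the
    same one.\<close>
  also have "emeasure padic_haar \<dots> = (\<integral>\<^sup>+c. emeasure padic_haar (f ` c) \<partial>count_space (C ` U))"
    using count disj_image
    by (intro emeasure_UN_countable) (auto simp: image sets_padic_haar borel_closed)
  also have "\<dots> = (\<integral>\<^sup>+c. emeasure padic_haar c \<partial>count_space (C ` U))"
  proof (rule nn_integral_cong)
    fix c assume "c \<in> space (count_space (C ` U))"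
    then obtain x where x: "x \<in> U" "c = C x" by auto
    then show "emeasure padic_haar (f ` c) = emeasure padic_haar c"
      by (simp only: image) (simp only: C_def emeasure_padic_haar_cball)
  qed
  also have "\<dots> = emeasure padic_haar (\<Union>((\<lambda>c. c) ` C ` U))"
    using count disj
    by (intro emeasure_UN_countable[symmetric]) (auto simp: C_def sets_padic_haar borel_closed)
  also have "\<Union>((\<lambda>c. c) ` C ` U) = U" using UC by simp
  finally show ?thesis by (simp add: U_def B_def)
qed

text \<open>Balls suffice: the push-forward of Haar measure gives every ball its radius, and
  \<open>padic_measure_eqI\<close> identifies it with Haar measure.\<close>

lemma bij_locally_isometric_imp_measure_preserving:
  fixes f :: "'p::prime_card padic \<Rightarrow> 'p padic"
  assumes bij: "bij f" and iso: "locally_isometric f"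
  shows "measure_preserving padic_haar f"
proof -
  have "f \<in> measurable borel borel"
    using locally_isometric_imp_continuous[OF iso] by (rule borel_measurable_continuous_onI)
  then have m: "f \<in> measurable padic_haar padic_haar"
    by (simp only: measurable_cong_sets[OF sets_padic_haar sets_padic_haar])
  have "distr padic_haar padic_haar f = padic_haar"
  proof (rule padic_measure_eqI)
    fix a :: "'p padic" and k
    have "cball a (real CARD('p) powi k) \<in> sets padic_haar"
      by (simp add: sets_padic_haar borel_closed)
    then show "emeasure (distr padic_haar padic_haar f) (cball a (real CARD('p) powi k))
        = ennreal (real CARD('p) powi k)"
      using emeasure_vimage_cball[OF bij iso, of a k] m
      by (simp only: emeasure_distr space_padic_haar Int_UNIV_right emeasure_padic_haar_cball)
  qed (simp_all only: sets_distr sets_padic_haar emeasure_padic_haar_cball)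
  then have "emeasure padic_haar (f -` A \<inter> space padic_haar) = emeasure padic_haar A"
    if "A \<in> sets padic_haar" for A
    using emeasure_distr[OF m that] by simp
  with m show ?thesis by (simp add: measure_preserving_def)
qed

theorem corollary5p7:
  fixes f :: "'p::prime_card padic \<Rightarrow> 'p padic"
  assumes "padic_rational_function f"
    and "locally_1_lipschitz f"
  shows "measure_preserving padic_haar f \<longleftrightarrow> bij f \<and> locally_isometric f"
proof
  assume f: "measure_preserving padic_haar f"
  obtain P Q where Q: "\<And>x. poly Q x \<noteq> 0" and PQ: "\<And>x. f x = poly P x / poly Q x"
    using assms(1) unfolding padic_rational_function_def by blast
  obtain h where h: "continuous_on UNIV h" "\<And>x y. f x - f y = (x - y) * h (x, y)"
    using rational_difference_quotient[OF Q PQ] by blast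
  have Q0: "Q \<noteq> 0" using Q[of 0] by auto
  have "continuous_on UNIV f"
    using continuous_on_padic_rational[OF Q, of UNIV P] by (simp add: PQ)
  \<comment> \<open>The degree comparison supplies the properness that turns density of the image
    into surjectivity.\<close>
  then have "surj f"
    using measure_preserving_rational_proper[OF f Q0 PQ]
    by (intro measure_preserving_proper_imp_surj[OF f]) metis+
  then show "bij f \<and> locally_isometric f"
    using measure_preserving_imp_inj[OF f assms(2)]
      measure_preserving_imp_locally_isometric[OF f assms(2) h] by (simp add: bij_def)
qed (simp add: bij_locally_isometric_imp_measure_preserving)

end
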